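(* Let $d\ge1$ and let $\rho\in\mathcal P(\mathbb S_\succ^d)$ be absolutely continuous, spectrally invariant, and have finite second moment with respect to the Frobenius norm. For $\Sigma_0,\Sigma_1\in\mathbb S_\succ^d$ define $\mu_i=\alpha(\Sigma_i^{1/2})_\#\rho$, $i=0,1$, and set $C=(\Sigma_0^{1/2}\Sigma_1\Sigma_0^{1/2})^{1/2}$. Then for the quadratic cost $c(X,Y)=\|X-Y\|_{\mathrm F}^2$: (a) the unique optimal Monge map from $\mu_0$ to $\mu_1$ is $$T^\star(X)=A^\star XA^\star,\qquad A^\star=\Sigma_0^{-1/2}\bigl(\Sigma_0^{1/2}\Sigma_1\Sigma_0^{1/2}\bigr)^{1/2}\Sigma_0^{-1/2},$$ where $A^\star$ is symmetric positive definite; (b) $(\mathrm{id},T^\star)_\#\mu_0$ is the unique optimal Kantorovich plan; (c) the optimal transport cost is $$\mathds K_c(\mu_0,\mu_1)=(a_\rho+b_\rho)\|\Sigma_0-\Sigma_1\|_{\mathrm F}^2+b_\rho\bigl((\mathrm{Tr}\,\Sigma_0)^2+(\mathrm{Tr}\,\Sigma_1)^2-2(\mathrm{Tr}\,C)^2\bigr),$$ where for $d\ge2$ $$b_\rho=\frac{\mathbb E_{X\sim\rho}[\mathrm{Tr}(X^2)]-\frac1d\mathbb E_{X\sim\rho}[(\mathrm{Tr}\,X)^2]}{d^2+d-2},\qquad a_\rho=\frac{\mathbb E_{X\sim\rho}[(\mathrm{Tr}\,X)^2]-2b_\rho d}{d^2},$$ and for $d=1$ the numbers $a_\rho,b_\rho$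 are not separately identified, but the formula holds for any $a_\rho,b_\rho$ with $a_\rho+2b_\rho=\mathbb E_{X\sim\rho}[X^2]$ (the value depends only on this combination); (d) $\mathds M_c(\mu_0,\mu_1)=\mathds K_c(\mu_0,\mu_1)=\mathds J_c(\Sigma_0^{1/2},\Sigma_1^{1/2})$.
   Context: $\mathbb S_\succ^d$ is the cone of real symmetric positive definite $d\times d$ matrices, an open subset of the space $\mathrm{Sym}(d)$ of real symmetric matrices with Frobenius inner product $\langle X,Y\rangle=\mathrm{Tr}(XY)$ and norm $\|\cdot\|_{\mathrm F}$. $\mathcal P(\mathbb S_\succ^d)$ denotes Borel probability measures; absolutely continuous means with respect to Lebesgue measure on $\mathrm{Sym}(d)$. $\mathrm{GL}(d)$ acts on $\mathbb S_\succ^d$ by congruence, $\alpha(A)(X)=AXA^\top$. $\mathcal O(d)$ is the orthogonal group. $\rho$ is spectrally invariant if $\alpha(Q)_\#\rho=\rho$ for every $Q\in\mathcal O(d)$. $\mathrm{Stab}_{\mathrm{GL}(d)}(\rho)=\{A\in\mathrm{GL}(d):\alpha(A)_\#\rho=\rho\}$. Square roots are the positive definite ones; $T_\#\mu(B)=\mu(T^{-1}(B))$. With $\mathcal X=\mathbb S_\succ^d$: $\mathds M_c(\mu_0,\mu_1)=\inf_T\int c(X,T(X))\,d\mu_0(X)$ over Borel $T:\mathcal X\to\mathcal X$ with $T_\#\mu_0=\mu_1$ (a minimizer is an optimal Monge map; uniqueness is up to $\mu_0$-a.e. equality); $\mathds K_c(\mu_0,\mu_1)=\inf_\Gamma\int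 c\,d\Gamma$ over probability measures $\Gamma$ on $\mathcal X\times\mathcal X$ with marginals $\mu_0,\mu_1$ (a minimizer is an optimal Kantorovich plan); $\mathds J_c(g_0,g_1)=\inf_{h\in\mathrm{Stab}_{\mathrm{GL}(d)}(\rho)}\int c(\alpha(g_0)(X),\alpha(g_1h)(X))\,d\rho(X)$. *)

theory Defs
  imports "HOL-Probability.Probability"
begin

text \<open>
  The index type \<open>'n\<close> has \<open>d = CARD('n) \<ge> 1\<close> elements. The library norm on \<open>real^'n^'n\<close>
  is the Frobenius norm; on symmetric matrices the library inner product is \<open>Tr (X Y)\<close>.
\<close>

lemma norm_power2_eq_trace: "(norm X)\<^sup>2 = trace (X ** transpose X)" for X :: "real^'n^'n"
  by (simp add: power2_norm_eq_inner inner_vec_def trace_def matrix_matrix_mult_def transpose_def)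

lemma inner_eq_trace: "X \<bullet> Y = trace (X ** Y)"
  if "transpose Y = Y" for X Y :: "real^'n^'n"
proof -
  have "Y $ j $ i = Y $ i $ j" for i j
    by (metis that transpose_def vec_lambda_beta)
  then show ?thesis
    by (simp add: inner_vec_def trace_def matrix_matrix_mult_def)
qed

definition Sym :: "(real^'n^'n) set"
  where "Sym = {X. transpose X = X}"

definition spd :: "(real^'n^'n) set"
  where "spd = {X \<in> Sym. \<forall>v. v \<noteq> 0 \<longrightarrow> v \<bullet> (X *v v) > 0}"

definition spd_sqrt :: "real^'n^'n \<Rightarrow> real^'n^'n"
  where "spd_sqrt X = (THE Y. Y \<in> spd \<and> Y ** Y = X)"


text \<open>
  Lebesgue measure on the Euclidean space \<open>Sym\<close> is the image of the product Lebesgue measure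
  under coordinates in an orthonormal basis, in the same way as \<open>lborel\<close> is built from \<open>Basis\<close>.
  It is a measure on the ambient matrix space, concentrated on \<open>Sym\<close>. The pairs \<open>(i, j)\<close> and
  \<open>(j, i)\<close> give the same element of the set \<open>sym_basis\<close>.
\<close>

definition mat_unit :: "'n \<Rightarrow> 'n \<Rightarrow> real^'n^'n"
  where "mat_unit i j = axis i (axis j 1)"

definition sym_basis :: "(real^'n^'n) set"
  where "sym_basis = {mat_unit i i | i. True} \<union>
    {(1 / sqrt 2) *\<^sub>R (mat_unit i j + mat_unit j i) | i j. i \<noteq> j}"

definition lborel_sym :: "(real^'n^'n) measure"
  where "lborel_sym =
    distr (\<Pi>\<^sub>M b\<in>sym_basis. (lborel :: real measure)) borel (\<lambda>x. \<Sum>b\<in>sym_basis. x b *\<^sub>R b)"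

lemma mat_unit_nth: "mat_unit i j $ k $ l = (if k = i \<and> l = j then 1 else 0)"
  by (simp add: mat_unit_def axis_def)

lemma inner_mat_unit: "X \<bullet> mat_unit i j = X $ i $ j"
  by (simp add: mat_unit_def inner_axis)

lemma norm_sym_basis: "b \<in> sym_basis \<Longrightarrow> norm b = 1"
  unfolding norm_eq_1
  by (auto simp: sym_basis_def inner_mat_unit mat_unit_nth inner_add_right)

lemma pairwise_orthogonal_sym_basis: "pairwise orthogonal sym_basis"
  unfolding pairwise_def orthogonal_def
  by (auto simp: sym_basis_def inner_mat_unit mat_unit_nth inner_add_right add.commute)

lemma Sym_iff: "X \<in> Sym \<longleftrightarrow> (\<forall>i j. X $ i $ j = X $ j $ i)"
  unfolding Sym_def transpose_def vec_eq_iff by auto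

lemma span_sym_basis: "span sym_basis = (Sym :: (real^'n^'n) set)"
proof
  have "subspace (Sym :: (real^'n^'n) set)"
    unfolding subspace_def
    by (metis (no_types, opaque_lifting) Sym_iff vector_add_component vector_scaleR_component zero_index)
  moreover have "sym_basis \<subseteq> (Sym :: (real^'n^'n) set)"
    unfolding subset_iff Sym_iff by (auto simp: sym_basis_def mat_unit_nth)
  ultimately show "span sym_basis \<subseteq> (Sym :: (real^'n^'n) set)"
    by (rule span_minimal[rotated])
next
  show "(Sym :: (real^'n^'n) set) \<subseteq> span sym_basis"
  proof
    fix X :: "real^'n^'n"
    assume X: "X \<in> Sym"
    have sym: "X $ i $ j = X $ j $ i" for i j
      using X unfolding Sym_iff by blast
    have *: "mat_unit i j + mat_unit j i \<in> span sym_basis" for i j :: 'n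
    proof (cases "i = j")
      case True
      have "mat_unit i i \<in> span sym_basis"
        by (rule span_base) (auto simp: sym_basis_def)
      with True show ?thesis by (metis span_add)
    next
      case False
      then have "(1 / sqrt 2) *\<^sub>R (mat_unit i j + mat_unit j i) \<in> span sym_basis"
        by (intro span_base) (auto simp: sym_basis_def)
      from span_scale[OF this, of "sqrt 2"] show ?thesis by simp
    qed
    have "(\<Sum>i\<in>UNIV. \<Sum>j\<in>UNIV. (X $ i $ j / 2) *\<^sub>R (mat_unit i j + mat_unit j i)) $ k $ l
        = X $ k $ l" for k l
    proof -
      have "(\<Sum>i\<in>UNIV. \<Sum>j\<in>UNIV. (X $ i $ j / 2) *\<^sub>R (mat_unit i j + mat_unit j i)) $ k $ l
        = (\<Sum>i\<in>UNIV. \<Sum>j\<in>UNIV. (if k = i then if l = j then X $ i $ j / 2 else 0 else 0)) +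
          (\<Sum>i\<in>UNIV. \<Sum>j\<in>UNIV. (if l = i then if k = j then X $ i $ j / 2 else 0 else 0))"
        unfolding sum.distrib[symmetric] sum_component
        by (intro sum.cong refl) (auto simp: mat_unit_nth)
      also have "(\<Sum>i\<in>UNIV. \<Sum>j\<in>UNIV. (if k = i then if l = j then X $ i $ j / 2 else 0 else 0))
          = (\<Sum>i\<in>UNIV. if k = i then X $ i $ l / 2 else 0)"
        by (intro sum.cong refl) auto
      also have "(\<Sum>i\<in>UNIV. \<Sum>j\<in>UNIV. (if l = i then if k = j then X $ i $ j / 2 else 0 else 0))
          = (\<Sum>i\<in>UNIV. if l = i then X $ i $ k / 2 else 0)"
        by (intro sum.cong refl) auto
      finally show ?thesis using sym[of k l] by simp
    qed
    then have "X = (\<Sum>i\<in>UNIV. \<Sum>j\<in>UNIV. (X $ i $ j / 2) *\<^sub>R (mat_unit i j + mat_unit j i))"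
      by (simp add: vec_eq_iff)
    then show "X \<in> span sym_basis"
      by (metis (no_types, lifting) * span_scale span_sum)
  qed
qed


text \<open>
  Borel measures on \<open>spd\<close> are represented as measures whose space is the set \<open>spd\<close>.
\<close>

definition borel_spd :: "(real^'n^'n) measure"
  where "borel_spd = restrict_space borel spd"

definition borel_prob_spd :: "(real^'n^'n) measure \<Rightarrow> bool"
  where "borel_prob_spd \<mu> \<longleftrightarrow> prob_space \<mu> \<and> sets \<mu> = sets borel_spd"

definition abs_cont_spd :: "(real^'n^'n) measure \<Rightarrow> bool"
  where "abs_cont_spd \<mu> \<longleftrightarrow> absolutely_continuous (restrict_space lborel_sym spd) \<mu>"

definition congr :: "real^'n^'n \<Rightarrow> real^'n^'n \<Rightarrow> real^'n^'n"
  where "congr A X = A ** X ** transpose A"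

definition spectrally_invariant :: "(real^'n^'n) measure \<Rightarrow> bool"
  where "spectrally_invariant \<rho> \<longleftrightarrow>
    (\<forall>Q. orthogonal_matrix Q \<longrightarrow> distr \<rho> borel_spd (congr Q) = \<rho>)"

definition Stab_GL :: "(real^'n^'n) measure \<Rightarrow> (real^'n^'n) set"
  where "Stab_GL \<rho> = {A. invertible A \<and> distr \<rho> borel_spd (congr A) = \<rho>}"


type_synonym 'n cost = "real^'n^'n \<Rightarrow> real^'n^'n \<Rightarrow> ennreal"

definition quad_cost :: "'n::finite cost"
  where "quad_cost X Y = ennreal ((norm (X - Y))\<^sup>2)"

definition transport_maps ::
    "(real^'n^'n) measure \<Rightarrow> (real^'n^'n) measure \<Rightarrow> (real^'n^'n \<Rightarrow> real^'n^'n) set"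
  where "transport_maps \<mu>0 \<mu>1 = {T \<in> borel_spd \<rightarrow>\<^sub>M borel_spd. distr \<mu>0 borel_spd T = \<mu>1}"

definition monge_cost ::
    "'n::finite cost \<Rightarrow> (real^'n^'n) measure \<Rightarrow> (real^'n^'n) measure \<Rightarrow> ennreal"
  where "monge_cost c \<mu>0 \<mu>1 = (INF T\<in>transport_maps \<mu>0 \<mu>1. \<integral>\<^sup>+X. c X (T X) \<partial>\<mu>0)"

definition optimal_monge_map ::
    "'n::finite cost \<Rightarrow> (real^'n^'n) measure \<Rightarrow> (real^'n^'n) measure \<Rightarrow>
      (real^'n^'n \<Rightarrow> real^'n^'n) \<Rightarrow> bool"
  where "optimal_monge_map c \<mu>0 \<mu>1 T \<longleftrightarrow>
    T \<in> transport_maps \<mu>0 \<mu>1 \<and> (\<integral>\<^sup>+X. c X (T X) \<partial>\<mu>0) = monge_cost c \<mu>0 \<mu>1"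

definition unique_optimal_monge_map ::
    "'n::finite cost \<Rightarrow> (real^'n^'n) measure \<Rightarrow> (real^'n^'n) measure \<Rightarrow>
      (real^'n^'n \<Rightarrow> real^'n^'n) \<Rightarrow> bool"
  where "unique_optimal_monge_map c \<mu>0 \<mu>1 T \<longleftrightarrow>
    optimal_monge_map c \<mu>0 \<mu>1 T \<and>
    (\<forall>T'. optimal_monge_map c \<mu>0 \<mu>1 T' \<longrightarrow> (AE X in \<mu>0. T' X = T X))"

definition couplings ::
    "(real^'n^'n) measure \<Rightarrow> (real^'n^'n) measure \<Rightarrow> ((real^'n^'n) \<times> (real^'n^'n)) measure set"
  where "couplings \<mu>0 \<mu>1 =
    {\<Gamma>. prob_space \<Gamma> \<and> sets \<Gamma> = sets (borel_spd \<Otimes>\<^sub>M borel_spd) \<and>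
      distr \<Gamma> borel_spd fst = \<mu>0 \<and> distr \<Gamma> borel_spd snd = \<mu>1}"

definition kantorovich_cost ::
    "'n::finite cost \<Rightarrow> (real^'n^'n) measure \<Rightarrow> (real^'n^'n) measure \<Rightarrow> ennreal"
  where "kantorovich_cost c \<mu>0 \<mu>1 = (INF \<Gamma>\<in>couplings \<mu>0 \<mu>1. \<integral>\<^sup>+(X, Y). c X Y \<partial>\<Gamma>)"

definition optimal_plan ::
    "'n::finite cost \<Rightarrow> (real^'n^'n) measure \<Rightarrow> (real^'n^'n) measure \<Rightarrow>
      ((real^'n^'n) \<times> (real^'n^'n)) measure \<Rightarrow> bool"
  where "optimal_plan c \<mu>0 \<mu>1 \<Gamma> \<longleftrightarrow>
    \<Gamma> \<in> couplings \<mu>0 \<mu>1 \<and> (\<integral>\<^sup>+(X, Y). c X Y \<partial>\<Gamma>) = kantorovich_cost c \<mu>0 \<mu>1"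

definition unique_optimal_plan ::
    "'n::finite cost \<Rightarrow> (real^'n^'n) measure \<Rightarrow> (real^'n^'n) measure \<Rightarrow>
      ((real^'n^'n) \<times> (real^'n^'n)) measure \<Rightarrow> bool"
  where "unique_optimal_plan c \<mu>0 \<mu>1 \<Gamma> \<longleftrightarrow>
    optimal_plan c \<mu>0 \<mu>1 \<Gamma> \<and> (\<forall>\<Gamma>'. optimal_plan c \<mu>0 \<mu>1 \<Gamma>' \<longrightarrow> \<Gamma>' = \<Gamma>)"

definition J_cost ::
    "'n::finite cost \<Rightarrow> (real^'n^'n) measure \<Rightarrow> real^'n^'n \<Rightarrow> real^'n^'n \<Rightarrow> ennreal"
  where "J_cost c \<rho> g0 g1 = (INF h\<in>Stab_GL \<rho>. \<integral>\<^sup>+X. c (congr g0 X) (congr (g1 ** h) X) \<partial>\<rho>)"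


definition b_coeff :: "(real^'n^'n) measure \<Rightarrow> real"
  where "b_coeff \<rho> =
    ((\<integral>X. trace (X ** X) \<partial>\<rho>) - 1 / real CARD('n) * (\<integral>X. (trace X)\<^sup>2 \<partial>\<rho>)) /
    ((real CARD('n))\<^sup>2 + real CARD('n) - 2)"

definition a_coeff :: "(real^'n^'n) measure \<Rightarrow> real"
  where "a_coeff \<rho> =
    ((\<integral>X. (trace X)\<^sup>2 \<partial>\<rho>) - 2 * b_coeff \<rho> * real CARD('n)) / (real CARD('n))\<^sup>2"

definition cost_formula ::
    "real \<Rightarrow> real \<Rightarrow> real^'n^'n \<Rightarrow> real^'n^'n \<Rightarrow> real^'n^'n \<Rightarrow> real"
  where "cost_formula a b \<Sigma>0 \<Sigma>1 C =
    (a + b) * (norm (\<Sigma>0 - \<Sigma>1))\<^sup>2 +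
    b * ((trace \<Sigma>0)\<^sup>2 + (trace \<Sigma>1)\<^sup>2 - 2 * (trace C)\<^sup>2)"

end

theory Submission
  imports Defs
begin

text \<open>
  The linear map \<open>X \<mapsto> A X A\<close> with \<open>A\<close> symmetric positive definite is self-adjoint and positive definite for
  the Frobenius inner product, with inverse \<open>Y \<mapsto> A\<^sup>-\<^sup>1 Y A\<^sup>-\<^sup>1\<close>; it is the gradient of the convex
  quadratic form \<open>\<langle>X, A X A\<rangle> / 2\<close>. For a quadratic potential Brenier's duality argument is a completion of
  squares: \<open>\<parallel>X - Y\<parallel>\<^sup>2\<close> is a function of \<open>X\<close> plus a function of \<open>Y\<close> plus the square of \<open>Y - A X A\<close> in the
  norm of the inverse map (\<open>norm_diff_eq_potentials_plus_gap\<close>). The first two terms have the same integral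
  under every coupling, and the third is nonnegative and vanishes exactly on the graph of the map. Hence,
  whenever \<open>X \<mapsto> A X A\<close> transports \<open>\<mu>0\<close> to \<open>\<mu>1\<close> and the second moments are finite, its graph carries the
  only optimal plan and the map is the only optimal map (\<open>congruence_transport_optimal\<close>).

  It remains to see that the given \<open>A\<close> transports \<open>\<mu>0\<close> to \<open>\<mu>1\<close>. Since \<open>A \<Sigma>0 A = \<Sigma>1\<close>, the matrix
  \<open>Q = \<Sigma>1\<^sup>-\<^sup>1\<^sup>/\<^sup>2 A \<Sigma>0\<^sup>1\<^sup>/\<^sup>2\<close> is orthogonal (\<open>congruence_factor_orthogonal\<close>), so that \<open>A \<Sigma>0\<^sup>1\<^sup>/\<^sup>2 = \<Sigma>1\<^sup>1\<^sup>/\<^sup>2 Q\<close>, and \<open>Q\<close>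
  preserves \<open>\<rho>\<close>. The same \<open>Q\<close> is an element of the stabilizer that attains the orbit cost, while any
  element of the stabilizer produces a coupling and therefore cannot do better.

  For the value of the cost, invariance under signed permutations and under one reflection
  that mixes two basis vectors forces \<open>E[X\<^sub>i\<^sub>j X\<^sub>k\<^sub>l] = a \<delta>\<^sub>i\<^sub>j \<delta>\<^sub>k\<^sub>l + b (\<delta>\<^sub>i\<^sub>k \<delta>\<^sub>j\<^sub>l + \<delta>\<^sub>i\<^sub>l \<delta>\<^sub>j\<^sub>k)\<close> (\<open>isotropic_moments_exist\<close>), so that
  \<open>E \<langle>X, P X P\<rangle> = (a + b) Tr (P\<^sup>2) + b (Tr P)\<^sup>2\<close> for symmetric \<open>P\<close>. This is used for \<open>P = \<Sigma>0\<close> and \<open>P = \<Sigma>1\<close>,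
  which give the second moments of the marginals, for \<open>P = C\<close>, which gives the cross term, and for
  \<open>P = I\<close>, which together with \<open>E (Tr X)\<^sup>2\<close> identifies \<open>a\<close> and \<open>b\<close>.
\<close>

section \<open>Square roots of positive operators\<close>

lemma positive_operator_coercive:
  fixes F :: "'a::euclidean_space \<Rightarrow>\<^sub>L 'a"
  assumes pos: "\<And>v. v \<noteq> 0 \<Longrightarrow> v \<bullet> F v > 0"
  shows "\<exists>m>0. \<forall>v. m * (norm v)\<^sup>2 \<le> v \<bullet> F v"
proof -
  let ?S = "sphere (0::'a) 1"
  obtain b :: 'a where "b \<in> Basis" using nonempty_Basis by blast
  then have ne: "?S \<noteq> {}" by (metis all_not_in_conv mem_sphere_0 norm_Basis)
  obtain w where w: "w \<in> ?S" "\<And>v. v \<in> ?S \<Longrightarrow> w \<bullet> F w \<le> v \<bullet> F v"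
    using continuous_attains_inf[OF compact_sphere ne, of "\<lambda>v. v \<bullet> F v"]
      continuous_on_inner[OF continuous_on_id blinfun.continuous_on[OF continuous_on_const continuous_on_id]]
    by blast
  have "(w \<bullet> F w) * (norm v)\<^sup>2 \<le> v \<bullet> F v" for v
  proof (cases "v = 0")
    case False
    then have "w \<bullet> F w \<le> (v /\<^sub>R norm v) \<bullet> F (v /\<^sub>R norm v)" by (intro w(2)) auto
    also have "\<dots> = (v \<bullet> F v) / (norm v)\<^sup>2"
      by (simp add: blinfun.bilinear_simps power2_eq_square divide_simps)
    finally show ?thesis using False by (simp add: divide_simps split: if_splits)
  qed simp
  moreover have "w \<bullet> F w > 0" using w(1) by (intro pos) auto
  ultimately show ?thesis by blast
qed

text \<open>
  Expanding the square, \<open>\<parallel>v - c F v\<parallel>\<^sup>2 \<le> (1 - 2 c m + c\<^sup>2 K\<^sup>2) \<parallel>v\<parallel>\<^sup>2\<close> when \<open>m\<close> bounds the form of \<open>F\<close> from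
  below and \<open>K \<ge> \<parallel>F\<parallel>\<close>. The factor is smallest for \<open>c = m / K\<^sup>2\<close>.
\<close>

lemma positive_operator_near_id:
  fixes F :: "'a::euclidean_space \<Rightarrow>\<^sub>L 'a"
  assumes pos: "\<And>v. v \<noteq> 0 \<Longrightarrow> v \<bullet> F v > 0"
  shows "\<exists>c>0. \<exists>r<1. 0 \<le> r \<and> norm (id_blinfun - c *\<^sub>R F) \<le> r"
proof -
  obtain m where m: "m > 0" "\<And>v. m * (norm v)\<^sup>2 \<le> v \<bullet> F v"
    using positive_operator_coercive[OF pos] by blast
  \<comment> \<open>Adding \<open>m\<close> keeps \<open>K\<close> positive and makes \<open>m \<le> K\<close> evident, so that the radicand below is nonnegative.\<close>
  define K where "K = norm F + m"
  define c where "c = m / K\<^sup>2"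
  have K: "K \<ge> m" "K > 0" using m(1) by (auto simp: K_def add_nonneg_pos)
  have c: "c > 0" using m(1) K by (simp add: c_def)
  define r where "r = sqrt (1 - m\<^sup>2 / K\<^sup>2)"
  have q: "0 \<le> 1 - m\<^sup>2 / K\<^sup>2" "1 - m\<^sup>2 / K\<^sup>2 < 1"
    using K m(1) by (auto simp: divide_simps power_mono)
  have r: "0 \<le> r" "r < 1" using q by (auto simp: r_def real_sqrt_lt_1_iff)
  have "norm ((id_blinfun - c *\<^sub>R F) v) \<le> r * norm v" for v
  proof (rule power2_le_imp_le)
    have "norm (F v) \<le> K * norm v"
      using norm_blinfun[of F v] m(1) by (simp add: K_def ring_distribs add_increasing2)
    then have Fv: "(norm (F v))\<^sup>2 \<le> K\<^sup>2 * (norm v)\<^sup>2"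
      by (metis norm_ge_zero power_mono power_mult_distrib)
    have "(norm ((id_blinfun - c *\<^sub>R F) v))\<^sup>2 = (norm v)\<^sup>2 - 2 * c * (v \<bullet> F v) + c\<^sup>2 * (norm (F v))\<^sup>2"
      unfolding power2_norm_eq_inner
      by (simp add: blinfun.bilinear_simps inner_diff inner_commute power2_eq_square algebra_simps)
    also have "\<dots> \<le> (norm v)\<^sup>2 - 2 * c * (m * (norm v)\<^sup>2) + c\<^sup>2 * (K\<^sup>2 * (norm v)\<^sup>2)"
      using m(2)[of v] Fv c by (intro add_mono diff_mono mult_left_mono) auto
    also have "\<dots> = (r * norm v)\<^sup>2"
      using K q(1) by (simp add: r_def c_def power_mult_distrib field_simps power2_eq_square)
    finally show "(norm ((id_blinfun - c *\<^sub>R F) v))\<^sup>2 \<le> (r * norm v)\<^sup>2" .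
  qed (use r in simp)
  then have "norm (id_blinfun - c *\<^sub>R F) \<le> r" using r by (intro norm_blinfun_bound) auto
  with c r show ?thesis by blast
qed

text \<open>
  After rescaling, \<open>F = id - E\<close> with \<open>\<parallel>E\<parallel> < 1\<close>. A square root of the form \<open>id - Y\<close> is a solution of
  \<open>Y = (E + Y\<^sup>2) / 2\<close>. The right-hand side is a contraction of the self-adjoint operators of norm at most
  \<open>r < 1\<close>, and \<open>\<parallel>Y\<parallel> < 1\<close> makes \<open>id - Y\<close> positive. This avoids the spectral theorem.
\<close>

lemma positive_operator_sqrt_exists:
  fixes F :: "'a::euclidean_space \<Rightarrow>\<^sub>L 'a"
  assumes adj: "\<And>u v. u \<bullet> F v = F u \<bullet> v"
    and pos: "\<And>v. v \<noteq> 0 \<Longrightarrow> v \<bullet> F v > 0"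
  shows "\<exists>G :: 'a \<Rightarrow>\<^sub>L 'a. (\<forall>u v. u \<bullet> G v = G u \<bullet> v) \<and> (\<forall>v. v \<noteq> 0 \<longrightarrow> v \<bullet> G v > 0) \<and>
    (\<forall>v. G (G v) = F v)"
proof -
  obtain c r where c: "c > 0" and r: "0 \<le> r" "r < 1" and E: "norm (id_blinfun - c *\<^sub>R F) \<le> r"
    using positive_operator_near_id[OF pos] by blast
  define E where "E = id_blinfun - c *\<^sub>R F"
  define S where "S = {Y :: 'a \<Rightarrow>\<^sub>L 'a. (\<forall>u v. u \<bullet> blinfun_apply Y v = blinfun_apply Y u \<bullet> v) \<and> norm Y \<le> r}"
  define f where "f = (\<lambda>Y. (1/2) *\<^sub>R (E + (Y o\<^sub>L Y)))"
  have cl: "closed S"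
    unfolding S_def Collect_conj_eq
    by (intro closed_Int closed_Collect_all closed_Collect_eq closed_Collect_le continuous_intros)
  have S0: "0 \<in> S" using r by (simp add: S_def)
  have fS: "f Y \<in> S" if "Y \<in> S" for Y
  proof -
    have Ya: "u \<bullet> Y v = Y u \<bullet> v" and Yn: "norm Y \<le> r" for u v using that by (auto simp: S_def)
    have "u \<bullet> f Y v = f Y u \<bullet> v" for u v
    proof -
      have "u \<bullet> E v = E u \<bullet> v" by (simp add: E_def blinfun.bilinear_simps inner_diff adj)
      moreover have "u \<bullet> Y (Y v) = Y (Y u) \<bullet> v" by (simp add: Ya)
      ultimately show ?thesis by (simp add: f_def blinfun.bilinear_simps inner_add)
    qed
    moreover have "norm (f Y) \<le> r"
    proof -
      have "norm (Y o\<^sub>L Y) \<le> r * r"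
        by (rule order_trans[OF norm_blinfun_compose]) (use Yn r in \<open>auto intro: mult_mono\<close>)
      also have "\<dots> \<le> r" using r by (simp add: mult_left_le)
      finally have "norm (E + (Y o\<^sub>L Y)) \<le> r + r"
        using E by (intro norm_triangle_mono) (auto simp: E_def)
      then show ?thesis by (simp add: f_def)
    qed
    ultimately show ?thesis by (simp add: S_def)
  qed
  have contr: "dist (f Y) (f Z) \<le> r * dist Y Z" if "Y \<in> S" "Z \<in> S" for Y Z
  proof -
    have n: "norm Y \<le> r" "norm Z \<le> r" using that by (auto simp: S_def)
    have "f Y - f Z = (1/2) *\<^sub>R (((Y - Z) o\<^sub>L Y) + (Z o\<^sub>L (Y - Z)))"
      by (rule blinfun_eqI) (simp add: f_def blinfun.bilinear_simps algebra_simps)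
    moreover have "norm ((Y - Z) o\<^sub>L Y) \<le> norm (Y - Z) * r"
      by (rule order_trans[OF norm_blinfun_compose]) (use n in \<open>auto intro: mult_left_mono\<close>)
    moreover have "norm (Z o\<^sub>L (Y - Z)) \<le> r * norm (Y - Z)"
      by (rule order_trans[OF norm_blinfun_compose]) (use n in \<open>auto intro: mult_right_mono\<close>)
    ultimately show ?thesis
      unfolding dist_norm
      using norm_triangle_ineq[of "(Y - Z) o\<^sub>L Y" "Z o\<^sub>L (Y - Z)"] by (simp add: mult.commute)
  qed
  have "\<exists>!Y\<in>S. f Y = Y"
    using cl S0 fS contr r by (intro Banach_fix[where c = r]) (auto simp: complete_eq_closed)
  then obtain Y where Y: "Y \<in> S" "f Y = Y" by blast
  define G where "G = (1 / sqrt c) *\<^sub>R (id_blinfun - Y)"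
  have Ya: "u \<bullet> Y v = Y u \<bullet> v" and Yn: "norm Y \<le> r" for u v using Y(1) by (auto simp: S_def)
  have "u \<bullet> G v = G u \<bullet> v" for u v
    by (simp add: G_def blinfun.bilinear_simps inner_diff Ya)
  moreover have "v \<bullet> G v > 0" if "v \<noteq> 0" for v
  proof -
    have "v \<bullet> Y v \<le> norm v * norm (Y v)" by (rule norm_cauchy_schwarz)
    also have "\<dots> \<le> norm v * (r * norm v)"
      using order_trans[OF norm_blinfun mult_right_mono[OF Yn norm_ge_zero]]
      by (intro mult_left_mono) auto
    also have "\<dots> < v \<bullet> v"
      using r that by (simp add: dot_square_norm power2_eq_square)
    finally show ?thesis using c by (simp add: G_def blinfun.bilinear_simps inner_diff_right)
  qed
  moreover have "G (G v) = F v" for v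
  proof -
    have "(1/2) *\<^sub>R (v - c *\<^sub>R F v + Y (Y v)) = Y v"
      using arg_cong[OF Y(2), of "\<lambda>Z. blinfun_apply Z v"]
      by (simp add: f_def E_def blinfun.bilinear_simps)
    then have "2 *\<^sub>R Y v = 2 *\<^sub>R ((1/2) *\<^sub>R (v - c *\<^sub>R F v + Y (Y v)))" by (simp only:)
    also have "\<dots> = v - c *\<^sub>R F v + Y (Y v)" by simp
    finally have "2 *\<^sub>R Y v = v - c *\<^sub>R F v + Y (Y v)" .
    then have "v - 2 *\<^sub>R Y v + Y (Y v) = c *\<^sub>R F v" by (simp add: algebra_simps)
    moreover have "G (G v) = (1 / c) *\<^sub>R (v - 2 *\<^sub>R Y v + Y (Y v))"
      using c by (simp add: G_def blinfun.bilinear_simps algebra_simps scaleR_2)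
    ultimately show ?thesis using c by simp
  qed
  ultimately show ?thesis by blast
qed

section \<open>Symmetric positive definite matrices\<close>

lemma inner_mult_left: "(A ** X) \<bullet> Y = X \<bullet> (transpose A ** Y)"
  for A X Y :: "real^'n^'n"
proof -
  have "(A ** X) \<bullet> Y = (\<Sum>i\<in>UNIV. \<Sum>j\<in>UNIV. \<Sum>k\<in>UNIV. A$i$k * X$k$j * Y$i$j)"
    by (simp add: inner_vec_def matrix_matrix_mult_def sum_distrib_right)
  also have "\<dots> = (\<Sum>i\<in>UNIV. \<Sum>k\<in>UNIV. \<Sum>j\<in>UNIV. A$i$k * X$k$j * Y$i$j)"
    by (intro sum.cong refl sum.swap)
  also have "\<dots> = (\<Sum>k\<in>UNIV. \<Sum>i\<in>UNIV. \<Sum>j\<in>UNIV. A$i$k * X$k$j * Y$i$j)"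
    by (rule sum.swap)
  also have "\<dots> = (\<Sum>k\<in>UNIV. \<Sum>j\<in>UNIV. \<Sum>i\<in>UNIV. A$i$k * X$k$j * Y$i$j)"
    by (intro sum.cong refl sum.swap)
  also have "\<dots> = X \<bullet> (transpose A ** Y)"
    by (simp add: inner_vec_def matrix_matrix_mult_def transpose_def sum_distrib_left mult_ac)
  finally show ?thesis .
qed

lemma inner_transpose: "transpose X \<bullet> transpose Y = X \<bullet> Y" for X Y :: "real^'n^'n"
  unfolding inner_vec_def transpose_def by (simp, rule sum.swap)

lemma inner_mult_right: "(X ** A) \<bullet> Y = X \<bullet> (Y ** transpose A)"
  for A X Y :: "real^'n^'n"
proof -
  have "(X ** A) \<bullet> Y = (transpose A ** transpose X) \<bullet> transpose Y"
    by (simp add: inner_transpose flip: matrix_transpose_mul)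
  also have "\<dots> = transpose X \<bullet> transpose (Y ** transpose A)"
    by (simp add: inner_mult_left matrix_transpose_mul)
  finally show ?thesis by (simp add: inner_transpose)
qed

lemma inner_matrix_vector_transpose: "u \<bullet> (A *v v) = (transpose A *v u) \<bullet> v"
  for A :: "real^'n^'n"
  by (metis dot_lmul_matrix transpose_transpose vector_transpose_matrix)

lemma inner_mult_columns: "X \<bullet> (Y ** X) = (\<Sum>j\<in>UNIV. column j X \<bullet> (Y *v column j X))"
  for X Y :: "real^'n^'n"
proof -
  have "X \<bullet> (Y ** X) = transpose X \<bullet> transpose (Y ** X)" by (simp add: inner_transpose)
  also have "\<dots> = (\<Sum>j\<in>UNIV. column j X \<bullet> (Y *v column j X))"
    by (simp add: inner_vec_def transpose_def column_def matrix_matrix_mult_def matrix_vector_mult_def)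
  finally show ?thesis .
qed

lemma matrix_diff_ldistrib: "A ** (B - C) = A ** B - A ** C" for A B C :: "real^'n^'n"
  by (simp add: matrix_matrix_mult_def vec_eq_iff algebra_simps sum_subtractf)

lemma matrix_diff_rdistrib: "(A - B) ** C = A ** C - B ** C" for A B C :: "real^'n^'n"
  by (simp add: matrix_matrix_mult_def vec_eq_iff algebra_simps sum_subtractf)

lemma spd_sym: "X \<in> spd \<Longrightarrow> transpose X = X"
  by (simp add: spd_def Sym_def)

lemma spd_pos: "X \<in> spd \<Longrightarrow> v \<noteq> 0 \<Longrightarrow> v \<bullet> (X *v v) > 0"
  by (simp add: spd_def)

lemma spdI: "transpose X = X \<Longrightarrow> (\<And>v. v \<noteq> 0 \<Longrightarrow> v \<bullet> (X *v v) > 0) \<Longrightarrow> X \<in> spd"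
  by (simp add: spd_def Sym_def)

lemma spd_nonneg: "X \<in> spd \<Longrightarrow> v \<bullet> (X *v v) \<ge> 0"
  by (cases "v = 0") (auto intro: less_imp_le spd_pos)

lemma inner_spd_mult_nonneg: "Y \<in> spd \<Longrightarrow> X \<bullet> (Y ** X) \<ge> 0" for X Y :: "real^'n^'n"
  unfolding inner_mult_columns by (intro sum_nonneg spd_nonneg)

lemma inner_spd_mult_eq_0:
  fixes X Y :: "real^'n^'n"
  assumes "Y \<in> spd" "X \<bullet> (Y ** X) = 0" shows "X = 0"
proof -
  have nn: "column j X \<bullet> (Y *v column j X) \<ge> 0" for j
    by (rule spd_nonneg[OF assms(1)])
  have "column j X \<bullet> (Y *v column j X) = 0" for j
    using assms(2) unfolding inner_mult_columns
    by (subst (asm) sum_nonneg_eq_0_iff) (auto intro: nn)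
  then have "column j X = 0" for j using assms(1) spd_pos by (metis less_irrefl)
  then show ?thesis by (simp add: column_def vec_eq_iff)
qed

text \<open>
  With \<open>D = Y - Z\<close>, the equation \<open>Y\<^sup>2 = Z\<^sup>2\<close> reads \<open>Y D + D Z = 0\<close>. Taking the inner product with \<open>D\<close>
  gives a sum of two nonnegative terms, and the vanishing of the first one forces \<open>D = 0\<close>.
\<close>

lemma spd_sqrt_unique:
  assumes "Y \<in> spd" "Z \<in> spd" "Y ** Y = Z ** Z"
  shows "Y = Z"
proof -
  let ?D = "Y - Z"
  have "Y ** ?D + ?D ** Z = 0"
    using assms(3) by (simp add: matrix_diff_ldistrib matrix_diff_rdistrib)
  then have "?D \<bullet> (Y ** ?D) + ?D \<bullet> (?D ** Z) = 0"
    by (metis inner_add_right inner_zero_right)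
  moreover have "?D \<bullet> (?D ** Z) = transpose ?D \<bullet> (Z ** transpose ?D)"
    by (metis assms(2) inner_transpose matrix_transpose_mul spd_sym)
  ultimately have "?D \<bullet> (Y ** ?D) = 0"
    using inner_spd_mult_nonneg[OF assms(1), of ?D] inner_spd_mult_nonneg[OF assms(2), of "transpose ?D"]
    by linarith
  then show ?thesis using inner_spd_mult_eq_0[OF assms(1)] by fastforce
qed

lemma spd_sqrt_exists:
  assumes X: "X \<in> spd"
  shows "\<exists>Y\<in>spd. Y ** Y = X"
proof -
  define F where "F = Blinfun ((*v) X)"
  have F: "blinfun_apply F = (*v) X"
    unfolding F_def by (rule bounded_linear_Blinfun_apply) (rule matrix_vector_mul_bounded_linear)
  obtain G :: "(real^'a) \<Rightarrow>\<^sub>L (real^'a)" where G: "\<And>u v. u \<bullet> G v = G u \<bullet> v"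
    "\<And>v. v \<noteq> 0 \<Longrightarrow> v \<bullet> G v > 0" "\<And>v. G (G v) = F v"
    using positive_operator_sqrt_exists[of F] spd_pos[OF X]
      inner_matrix_vector_transpose[where A = X, unfolded spd_sym[OF X]]
    unfolding F by metis
  let ?Y = "matrix (blinfun_apply G)"
  have Y: "?Y *v v = G v" for v
    by (metis matrix_vector_mul(1) blinfun.bounded_linear_right bounded_linear.linear matrix_works linear_matrix_vector_mul_eq)
  have "transpose ?Y *v u = G u" for u
    by (rule vector_eq_rdot[THEN iffD1]) (metis G(1) Y inner_matrix_vector_transpose)
  then have "transpose ?Y = ?Y" by (simp add: matrix_eq Y)
  moreover have "?Y ** ?Y = X"
    by (simp add: matrix_eq Y G F flip: matrix_vector_mul_assoc)
  ultimately show ?thesis using G(2) Y by (metis spdI)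
qed

lemma assumes "X \<in> spd"
  shows spd_sqrt_spd: "spd_sqrt X \<in> spd"
    and spd_sqrt_mult: "spd_sqrt X ** spd_sqrt X = X"
proof -
  have "\<exists>!Y. Y \<in> spd \<and> Y ** Y = X"
    using spd_sqrt_exists[OF assms] spd_sqrt_unique by blast
  from theI'[OF this] show "spd_sqrt X \<in> spd" "spd_sqrt X ** spd_sqrt X = X"
    by (simp_all add: spd_sqrt_def)
qed

lemma invertible_mult_eq_0: "invertible A \<Longrightarrow> A *v v = 0 \<Longrightarrow> v = 0" for A :: "real^'n^'n"
  by (metis invertible_left_inverse matrix_left_invertible_ker)

lemma spd_invertible: "X \<in> spd \<Longrightarrow> invertible X"
  by (metis inner_zero_right invertible_left_inverse less_irrefl matrix_left_invertible_ker spd_pos)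

lemma matrix_inv_right: "invertible A \<Longrightarrow> A ** matrix_inv A = mat 1"
  and matrix_inv_left: "invertible A \<Longrightarrow> matrix_inv A ** A = mat 1" for A :: "real^'n^'n"
  unfolding matrix_inv_def invertible_def by (metis (mono_tags, lifting) someI_ex)+

lemma matrix_inv_unique: "A ** B = mat 1 \<Longrightarrow> matrix_inv A = B" for A :: "real^'n^'n"
  by (metis invertible_right_inverse matrix_inv_left matrix_mul_assoc matrix_mul_lid matrix_mul_rid)

lemma invertible_matrix_inv: "invertible A \<Longrightarrow> invertible (matrix_inv A)" for A :: "real^'n^'n"
  by (metis invertible_right_inverse matrix_inv_left)

lemma congr_spd:
  assumes "invertible A" "X \<in> spd" shows "congr A X \<in> spd"
proof (rule spdI)
  show "transpose (congr A X) = congr A X"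
    by (simp add: congr_def matrix_transpose_mul spd_sym[OF assms(2)] matrix_mul_assoc)
next
  fix v :: "real^'a" assume "v \<noteq> 0"
  then have "transpose A *v v \<noteq> 0"
    using invertible_mult_eq_0 assms(1) transpose_invertible by blast
  from spd_pos[OF assms(2) this] show "v \<bullet> (congr A X *v v) > 0"
    by (simp add: congr_def inner_matrix_vector_transpose flip: matrix_vector_mul_assoc)
qed

lemma spd_inv:
  assumes "X \<in> spd" shows "matrix_inv X \<in> spd"
proof -
  have i: "invertible X" by (rule spd_invertible[OF assms])
  have t: "transpose (matrix_inv X) = matrix_inv X"
    by (metis assms i matrix_inv_left matrix_inv_unique matrix_transpose_mul spd_sym transpose_mat)
  have "congr (matrix_inv X) X = matrix_inv X"
    by (simp add: congr_def t matrix_inv_left i matrix_mul_rid)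
  with congr_spd[OF invertible_matrix_inv[OF i] assms] show ?thesis by simp
qed

lemma congr_congr: "congr A (congr B X) = congr (A ** B) X"
  by (simp add: congr_def matrix_transpose_mul matrix_mul_assoc)

section \<open>Quadratic potentials and the duality gap\<close>

text \<open>
  With \<open>R = B\<^sup>1\<^sup>/\<^sup>2\<close> the form equals \<open>\<langle>Z R, B Z R\<rangle>\<close>, which is positive unless \<open>Z R = 0\<close>.
\<close>

lemma inner_sandwich_nonneg:
  fixes B Z :: "real^'n^'n"
  assumes "B \<in> spd"
  shows "Z \<bullet> (B ** Z ** B) \<ge> 0" and "Z \<bullet> (B ** Z ** B) = 0 \<Longrightarrow> Z = 0"
proof -
  let ?R = "spd_sqrt B"
  have R: "?R \<in> spd" "?R ** ?R = B" using assms by (simp_all add: spd_sqrt_spd spd_sqrt_mult)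
  have *: "Z \<bullet> (B ** Z ** B) = (Z ** ?R) \<bullet> (B ** (Z ** ?R))"
    using inner_mult_right[of Z ?R "B ** Z ** ?R"]
    by (simp only: spd_sym[OF R(1)] matrix_mul_assoc[symmetric] R(2))
  show "Z \<bullet> (B ** Z ** B) \<ge> 0" unfolding * by (rule inner_spd_mult_nonneg[OF assms])
  assume "Z \<bullet> (B ** Z ** B) = 0"
  then have "Z ** ?R = 0" unfolding * by (rule inner_spd_mult_eq_0[OF assms])
  then have "Z ** ?R ** matrix_inv ?R = 0 ** matrix_inv ?R" by (simp only:)
  also have "\<dots> = 0" by (simp add: matrix_matrix_mult_def vec_eq_iff)
  also have "Z ** ?R ** matrix_inv ?R = Z"
    using matrix_inv_right[OF spd_invertible[OF R(1)]] by (simp flip: matrix_mul_assoc)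
  finally show "Z = 0" .
qed

text \<open>
  The slack in the Fenchel-Young inequality for the potential \<open>\<langle>X, A X A\<rangle> / 2\<close>, up to a factor 2: the
  squared distance of \<open>Y\<close> from the image of \<open>X\<close>, measured by the inverse of the map \<open>Z \<mapsto> A Z A\<close>.
\<close>

definition gap :: "real^'n^'n \<Rightarrow> real^'n^'n \<Rightarrow> real^'n^'n \<Rightarrow> real"
  where "gap A X Y = (Y - A ** X ** A) \<bullet> (matrix_inv A ** (Y - A ** X ** A) ** matrix_inv A)"

lemma gap_nonneg: "A \<in> spd \<Longrightarrow> gap A X Y \<ge> 0"
  unfolding gap_def by (rule inner_sandwich_nonneg(1)[OF spd_inv])

lemma gap_eq_0_iff: assumes A: "A \<in> spd" shows "gap A X Y = 0 \<longleftrightarrow> Y = A ** X ** A"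
proof
  assume "gap A X Y = 0"
  then have "Y - A ** X ** A = 0"
    unfolding gap_def by (rule inner_sandwich_nonneg(2)[OF spd_inv[OF A]])
  then show "Y = A ** X ** A" by simp
qed (simp add: gap_def)

text \<open>
  Completion of the square: the maps \<open>Z \<mapsto> A Z A\<close> and \<open>Z \<mapsto> A\<^sup>-\<^sup>1 Z A\<^sup>-\<^sup>1\<close> are self-adjoint and inverse to
  each other, so the cross terms of the gap collapse to \<open>- 2 \<langle>X, Y\<rangle>\<close>.
\<close>

lemma norm_diff_eq_potentials_plus_gap:
  fixes A X Y :: "real^'n^'n"
  assumes A: "A \<in> spd"
  shows "(norm (X - Y))\<^sup>2 = X \<bullet> (X - A ** X ** A) + Y \<bullet> (Y - matrix_inv A ** Y ** matrix_inv A) + gap A X Y"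
proof -
  let ?B = "matrix_inv A"
  have i: "invertible A" by (rule spd_invertible[OF A])
  note AB = matrix_inv_right[OF i] matrix_inv_left[OF i]
  have cancel: "?B ** (A ** X ** A) ** ?B = X"
  proof -
    have "?B ** (A ** X ** A) ** ?B = (?B ** A) ** X ** (A ** ?B)" by (simp add: matrix_mul_assoc)
    then show ?thesis by (simp add: AB)
  qed
  have cancel': "A ** (?B ** Y ** ?B) ** A = Y"
  proof -
    have "A ** (?B ** Y ** ?B) ** A = (A ** ?B) ** Y ** (?B ** A)" by (simp add: matrix_mul_assoc)
    then show ?thesis by (simp add: AB)
  qed
  have cross: "(A ** X ** A) \<bullet> (?B ** Y ** ?B) = X \<bullet> Y"
    by (simp only: inner_mult_right[of "A ** X" A] inner_mult_left[of A X] spd_sym[OF A]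
        matrix_mul_assoc[of A _ A] cancel')
  have "gap A X Y = Y \<bullet> (?B ** Y ** ?B) - 2 * (X \<bullet> Y) + X \<bullet> (A ** X ** A)"
    unfolding gap_def matrix_diff_ldistrib matrix_diff_rdistrib cancel
    by (simp add: inner_diff cross inner_commute)
  then show ?thesis
    unfolding power2_norm_eq_inner by (simp add: inner_diff inner_commute)
qed

section \<open>Measures on the positive definite cone\<close>

lemma space_borel_spd: "space borel_spd = spd"
  by (simp add: borel_spd_def space_restrict_space)

lemma continuous_sandwich: "continuous_on S (\<lambda>X. A ** X ** B)" for A B :: "real^'n^'n"
  unfolding matrix_matrix_mult_def by (intro continuous_intros)

lemma measurable_borel_spd_self:
  "f \<in> borel \<rightarrow>\<^sub>M borel \<Longrightarrow> (\<And>X. X \<in> spd \<Longrightarrow> f X \<in> spd) \<Longrightarrow> f \<in> borel_spd \<rightarrow>\<^sub>M borel_spd"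
  unfolding borel_spd_def by (rule measurable_restrict_space3) auto

lemma measurable_borel_spdI: "f \<in> borel \<rightarrow>\<^sub>M N \<Longrightarrow> f \<in> borel_spd \<rightarrow>\<^sub>M N"
  unfolding borel_spd_def by (rule measurable_restrict_space1)

lemma measurable_sandwich: "(\<lambda>X. A ** X ** B) \<in> borel \<rightarrow>\<^sub>M borel" for A B :: "real^'n^'n"
  by (intro borel_measurable_continuous_onI continuous_sandwich)

lemma measurable_congr: "invertible A \<Longrightarrow> congr A \<in> borel_spd \<rightarrow>\<^sub>M borel_spd"
  by (intro measurable_borel_spd_self congr_spd) (auto simp: congr_def[abs_def] intro: measurable_sandwich)

lemma borel_prob_spdD:
  assumes "borel_prob_spd \<mu>"
  shows "prob_space \<mu>" "sets \<mu> = sets borel_spd" "space \<mu> = spd"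
  using assms sets_eq_imp_space_eq[of \<mu> borel_spd] by (auto simp: borel_prob_spd_def space_borel_spd)

lemma measurable_prob_spd:
  "borel_prob_spd \<mu> \<Longrightarrow> f \<in> borel_spd \<rightarrow>\<^sub>M N \<Longrightarrow> f \<in> \<mu> \<rightarrow>\<^sub>M N"
  using measurable_cong_sets[OF borel_prob_spdD(2) refl] by blast

lemma borel_prob_spd_distr:
  assumes "borel_prob_spd \<mu>" "f \<in> borel_spd \<rightarrow>\<^sub>M borel_spd"
  shows "borel_prob_spd (distr \<mu> borel_spd f)"
  unfolding borel_prob_spd_def
  using prob_space.prob_space_distr[OF borel_prob_spdD(1) measurable_prob_spd] assms by auto

text \<open>
  The potentials, the squared norms of congruence images and the products of entries are all bounded by
  a multiple of the squared norm, so this is how the second moment assumption enters.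
\<close>

lemma integrable_quadratic_growth:
  fixes f :: "real^'n^'n \<Rightarrow> real"
  assumes \<mu>: "borel_prob_spd \<mu>" "integrable \<mu> (\<lambda>X. (norm X)\<^sup>2)"
    and f: "f \<in> borel_measurable borel" "\<And>X. \<bar>f X\<bar> \<le> c * (norm X)\<^sup>2"
  shows "integrable \<mu> f"
proof (rule Bochner_Integration.integrable_bound)
  show "integrable \<mu> (\<lambda>X. c * (norm X)\<^sup>2)" using \<mu>(2) by simp
  show "f \<in> borel_measurable \<mu>" by (intro measurable_prob_spd[OF \<mu>(1)] measurable_borel_spdI f)
  show "AE X in \<mu>. norm (f X) \<le> norm (c * (norm X)\<^sup>2)"
    using f(2) by (auto intro: order_trans[OF _ abs_ge_self])
qed

lemma sandwich_bound: "\<exists>c. \<forall>X. norm (A ** X ** B) \<le> c * norm X" for A B :: "real^'n^'n"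
proof -
  have "linear (\<lambda>X. A ** X ** B)"
    by (rule linearI) (simp_all add: matrix_matrix_mult_def vec_eq_iff algebra_simps sum.distrib sum_distrib_left)
  then show ?thesis using linear_bounded by blast
qed

lemma integrable_potential:
  fixes A :: "real^'n^'n"
  assumes \<mu>: "borel_prob_spd \<mu>" "integrable \<mu> (\<lambda>X. (norm X)\<^sup>2)"
  shows "integrable \<mu> (\<lambda>X. X \<bullet> (X - A ** X ** A))"
proof -
  obtain c where c: "\<And>X. norm (A ** X ** A) \<le> c * norm X" using sandwich_bound by blast
  have "\<bar>X \<bullet> (X - A ** X ** A)\<bar> \<le> (1 + c) * (norm X)\<^sup>2" for X
  proof -
    have "\<bar>X \<bullet> (X - A ** X ** A)\<bar> \<le> norm X * norm (X - A ** X ** A)"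
      by (rule Cauchy_Schwarz_ineq2)
    also have "\<dots> \<le> norm X * (norm X + c * norm X)"
      using c[of X] norm_triangle_ineq4[of X "A ** X ** A"] by (intro mult_left_mono) auto
    finally show ?thesis by (simp add: power2_eq_square algebra_simps)
  qed
  then show ?thesis
    by (intro integrable_quadratic_growth[OF \<mu>] borel_measurable_inner borel_measurable_diff
        measurable_sandwich) auto
qed

section \<open>Optimality of congruence transport\<close>

lemma couplingsD:
  assumes "\<Gamma> \<in> couplings \<mu>0 \<mu>1"
  shows "fst \<in> \<Gamma> \<rightarrow>\<^sub>M borel_spd" "snd \<in> \<Gamma> \<rightarrow>\<^sub>M borel_spd"
    "distr \<Gamma> borel_spd fst = \<mu>0" "distr \<Gamma> borel_spd snd = \<mu>1"
    "fst \<in> borel_measurable \<Gamma>" "snd \<in> borel_measurable \<Gamma>"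
proof -
  have s: "sets \<Gamma> = sets (borel_spd \<Otimes>\<^sub>M borel_spd)" using assms by (simp add: couplings_def)
  show f: "fst \<in> \<Gamma> \<rightarrow>\<^sub>M borel_spd" "snd \<in> \<Gamma> \<rightarrow>\<^sub>M borel_spd"
    unfolding measurable_cong_sets[OF s refl] by measurable
  show "fst \<in> borel_measurable \<Gamma>" "snd \<in> borel_measurable \<Gamma>"
    using measurable_compose[OF f(1) measurable_borel_spdI[OF measurable_ident]]
      measurable_compose[OF f(2) measurable_borel_spdI[OF measurable_ident]] by simp_all
qed (use assms in \<open>auto simp: couplings_def\<close>)

text \<open>
  The potentials depend on one marginal each, so \<open>K\<close> is the same for all couplings, and minimizing
  the cost is the same as minimizing the integral of the gap.
\<close>

lemma coupling_cost:
  fixes A :: "real^'n^'n"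
  assumes \<mu>0: "borel_prob_spd \<mu>0" "integrable \<mu>0 (\<lambda>X. (norm X)\<^sup>2)"
    and \<mu>1: "borel_prob_spd \<mu>1" "integrable \<mu>1 (\<lambda>X. (norm X)\<^sup>2)"
    and A: "A \<in> spd" and \<Gamma>: "\<Gamma> \<in> couplings \<mu>0 \<mu>1"
  defines "K \<equiv> (\<integral>X. X \<bullet> (X - A ** X ** A) \<partial>\<mu>0) +
    (\<integral>Y. Y \<bullet> (Y - matrix_inv A ** Y ** matrix_inv A) \<partial>\<mu>1)"
  shows "integrable \<Gamma> (\<lambda>p. gap A (fst p) (snd p))"
    and "(\<integral>\<^sup>+(X, Y). quad_cost X Y \<partial>\<Gamma>) = ennreal (K + (\<integral>p. gap A (fst p) (snd p) \<partial>\<Gamma>))"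
    and "K + (\<integral>p. gap A (fst p) (snd p) \<partial>\<Gamma>) \<ge> 0"
proof -
  note m = couplingsD[OF \<Gamma>]
  let ?c = "\<lambda>p :: (real^'n^'n) \<times> (real^'n^'n). (norm (fst p - snd p))\<^sup>2"
  let ?\<phi> = "\<lambda>X. X \<bullet> (X - A ** X ** A)"
  let ?\<psi> = "\<lambda>Y. Y \<bullet> (Y - matrix_inv A ** Y ** matrix_inv A)"
  have marg: "integrable \<Gamma> (\<lambda>p. f (fst p))" "(\<integral>p. f (fst p) \<partial>\<Gamma>) = (\<integral>X. f X \<partial>\<mu>0)"
    if "integrable \<mu>0 f" for f :: "real^'n^'n \<Rightarrow> real"
  proof -
    have f: "f \<in> borel_measurable borel_spd"
      using that measurable_cong_sets[OF borel_prob_spdD(2)[OF \<mu>0(1)] refl] by auto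
    show "integrable \<Gamma> (\<lambda>p. f (fst p))" using that f m by (metis integrable_distr_eq)
    show "(\<integral>p. f (fst p) \<partial>\<Gamma>) = (\<integral>X. f X \<partial>\<mu>0)" using f m by (metis integral_distr)
  qed
  have marg': "integrable \<Gamma> (\<lambda>p. f (snd p))" "(\<integral>p. f (snd p) \<partial>\<Gamma>) = (\<integral>X. f X \<partial>\<mu>1)"
    if "integrable \<mu>1 f" for f :: "real^'n^'n \<Rightarrow> real"
  proof -
    have f: "f \<in> borel_measurable borel_spd"
      using that measurable_cong_sets[OF borel_prob_spdD(2)[OF \<mu>1(1)] refl] by auto
    show "integrable \<Gamma> (\<lambda>p. f (snd p))" using that f m by (metis integrable_distr_eq)
    show "(\<integral>p. f (snd p) \<partial>\<Gamma>) = (\<integral>X. f X \<partial>\<mu>1)" using f m by (metis integral_distr)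
  qed
  have c: "integrable \<Gamma> ?c"
  proof (rule Bochner_Integration.integrable_bound)
    show "integrable \<Gamma> (\<lambda>p. 2 * (norm (fst p))\<^sup>2 + 2 * (norm (snd p))\<^sup>2)"
      using marg(1)[OF \<mu>0(2)] marg'(1)[OF \<mu>1(2)] by simp
    show "?c \<in> borel_measurable \<Gamma>" using m(5,6) by measurable
    have "(norm (X - Y))\<^sup>2 \<le> 2 * (norm X)\<^sup>2 + 2 * (norm Y)\<^sup>2" for X Y :: "real^'n^'n"
    proof -
      have "(norm (X - Y))\<^sup>2 \<le> (norm X + norm Y)\<^sup>2"
        by (intro power_mono norm_triangle_ineq4) simp
      also have "\<dots> \<le> 2 * (norm X)\<^sup>2 + 2 * (norm Y)\<^sup>2"
        using zero_le_power2[of "norm X - norm Y"] by (simp add: power2_eq_square algebra_simps)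
      finally show ?thesis .
    qed
    then show "AE p in \<Gamma>. norm (?c p) \<le> norm (2 * (norm (fst p))\<^sup>2 + 2 * (norm (snd p))\<^sup>2)" by simp
  qed
  have \<phi>: "integrable \<mu>0 ?\<phi>" and \<psi>: "integrable \<mu>1 ?\<psi>"
    by (intro integrable_potential \<mu>0 \<mu>1)+
  have g: "gap A (fst p) (snd p) = ?c p - ?\<phi> (fst p) - ?\<psi> (snd p)" for p
    using norm_diff_eq_potentials_plus_gap[OF A, of "fst p" "snd p"] by simp
  show "integrable \<Gamma> (\<lambda>p. gap A (fst p) (snd p))"
    unfolding g using c marg(1)[OF \<phi>] marg'(1)[OF \<psi>] by simp
  have "(\<integral>p. gap A (fst p) (snd p) \<partial>\<Gamma>) = (\<integral>p. ?c p \<partial>\<Gamma>) - K"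
    unfolding g K_def using c marg[OF \<phi>] marg'[OF \<psi>] by simp
  then have eq: "(\<integral>p. ?c p \<partial>\<Gamma>) = K + (\<integral>p. gap A (fst p) (snd p) \<partial>\<Gamma>)" by simp
  show "K + (\<integral>p. gap A (fst p) (snd p) \<partial>\<Gamma>) \<ge> 0" unfolding eq[symmetric] by simp
  show "(\<integral>\<^sup>+(X, Y). quad_cost X Y \<partial>\<Gamma>) = ennreal (K + (\<integral>p. gap A (fst p) (snd p) \<partial>\<Gamma>))"
    unfolding eq[symmetric] quad_cost_def
    by (subst nn_integral_eq_integral[OF c, symmetric]) (auto simp: case_prod_beta')
qed

lemma measurable_quad_cost: "case_prod quad_cost \<in> borel_measurable (borel_spd \<Otimes>\<^sub>M borel_spd)"
proof -
  note to_borel = measurable_borel_spdI[OF measurable_ident_sets[OF refl]]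
  have [measurable]: "fst \<in> borel_measurable (borel_spd \<Otimes>\<^sub>M (borel_spd :: (real^'a^'a) measure))"
    by (rule measurable_compose[OF measurable_fst to_borel])
  have [measurable]: "snd \<in> borel_measurable ((borel_spd :: (real^'a^'a) measure) \<Otimes>\<^sub>M borel_spd)"
    by (rule measurable_compose[OF measurable_snd to_borel])
  have "(\<lambda>p :: (real^'a^'a) \<times> (real^'a^'a). ennreal ((norm (fst p - snd p))\<^sup>2)) \<in> borel_measurable (borel_spd \<Otimes>\<^sub>M borel_spd)"
    by measurable
  then show ?thesis by (simp add: quad_cost_def case_prod_beta')
qed

lemma coupling_of_maps:
  assumes \<rho>: "borel_prob_spd \<rho>" and f: "f \<in> borel_spd \<rightarrow>\<^sub>M borel_spd" and g: "g \<in> borel_spd \<rightarrow>\<^sub>M borel_spd"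
  defines "\<Gamma> \<equiv> distr \<rho> (borel_spd \<Otimes>\<^sub>M borel_spd) (\<lambda>X. (f X, g X))"
  shows "\<Gamma> \<in> couplings (distr \<rho> borel_spd f) (distr \<rho> borel_spd g)"
    and "(\<integral>\<^sup>+(X, Y). quad_cost X Y \<partial>\<Gamma>) = (\<integral>\<^sup>+X. quad_cost (f X) (g X) \<partial>\<rho>)"
proof -
  have m: "(\<lambda>X. (f X, g X)) \<in> \<rho> \<rightarrow>\<^sub>M borel_spd \<Otimes>\<^sub>M borel_spd"
    by (intro measurable_prob_spd[OF \<rho>] measurable_Pair f g)
  show "\<Gamma> \<in> couplings (distr \<rho> borel_spd f) (distr \<rho> borel_spd g)"
    using prob_space.prob_space_distr[OF borel_prob_spdD(1)[OF \<rho>] m]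
    by (simp add: couplings_def \<Gamma>_def distr_distr[OF measurable_fst m] distr_distr[OF measurable_snd m] comp_def)
  show "(\<integral>\<^sup>+(X, Y). quad_cost X Y \<partial>\<Gamma>) = (\<integral>\<^sup>+X. quad_cost (f X) (g X) \<partial>\<rho>)"
    unfolding \<Gamma>_def by (subst nn_integral_distr[OF m]) (simp_all add: measurable_quad_cost)
qed

text \<open>
  The coupling on the graph of \<open>T\<close> has gap 0 and attains the bound \<open>K\<close>. Any coupling that attains it has
  gap 0 almost everywhere, so it sits on the graph, and a coupling on a graph is determined by its
  first marginal. Competing maps are covered by the plans on their graphs.
\<close>

lemma congruence_transport_optimal:
  fixes A :: "real^'n^'n"
  assumes \<mu>0: "borel_prob_spd \<mu>0" "integrable \<mu>0 (\<lambda>X. (norm X)\<^sup>2)"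
    and \<mu>1: "borel_prob_spd \<mu>1" "integrable \<mu>1 (\<lambda>X. (norm X)\<^sup>2)"
    and A: "A \<in> spd"
  defines "T \<equiv> \<lambda>X. A ** X ** A"
  assumes T: "distr \<mu>0 borel_spd T = \<mu>1"
  shows "unique_optimal_plan quad_cost \<mu>0 \<mu>1 (distr \<mu>0 (borel_spd \<Otimes>\<^sub>M borel_spd) (\<lambda>X. (X, T X)))"
    and "unique_optimal_monge_map quad_cost \<mu>0 \<mu>1 T"
    and "monge_cost quad_cost \<mu>0 \<mu>1 = kantorovich_cost quad_cost \<mu>0 \<mu>1"
    and "kantorovich_cost quad_cost \<mu>0 \<mu>1 = (\<integral>\<^sup>+X. quad_cost X (T X) \<partial>\<mu>0)"
proof -
  define plan where "plan S = distr \<mu>0 (borel_spd \<Otimes>\<^sub>M borel_spd) (\<lambda>X. (X, S X))"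
    for S :: "real^'n^'n \<Rightarrow> real^'n^'n"
  have Tm: "T \<in> borel_spd \<rightarrow>\<^sub>M borel_spd"
    using measurable_congr[OF spd_invertible[OF A]]
    by (simp add: T_def congr_def[abs_def] spd_sym[OF A])
  have Tmap: "T \<in> transport_maps \<mu>0 \<mu>1" using Tm T by (simp add: transport_maps_def)
  have id: "distr \<mu>0 borel_spd (\<lambda>X. X) = \<mu>0"
    by (rule distr_id2) (simp add: borel_prob_spdD(2)[OF \<mu>0(1)])
  have plan: "plan S \<in> couplings \<mu>0 \<mu>1"
    "(\<integral>\<^sup>+(X, Y). quad_cost X Y \<partial>plan S) = (\<integral>\<^sup>+X. quad_cost X (S X) \<partial>\<mu>0)"
    if "S \<in> transport_maps \<mu>0 \<mu>1" for S
  proof -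
    have S: "S \<in> borel_spd \<rightarrow>\<^sub>M borel_spd" "distr \<mu>0 borel_spd S = \<mu>1"
      using that by (auto simp: transport_maps_def)
    show "plan S \<in> couplings \<mu>0 \<mu>1"
      "(\<integral>\<^sup>+(X, Y). quad_cost X Y \<partial>plan S) = (\<integral>\<^sup>+X. quad_cost X (S X) \<partial>\<mu>0)"
      using coupling_of_maps[OF \<mu>0(1) measurable_ident_sets[OF refl] S(1)]
      by (simp_all add: plan_def S(2) id)
  qed
  have pm: "(\<lambda>X. (X, S X)) \<in> \<mu>0 \<rightarrow>\<^sub>M borel_spd \<Otimes>\<^sub>M borel_spd" if "S \<in> borel_spd \<rightarrow>\<^sub>M borel_spd" for S
    by (intro measurable_prob_spd[OF \<mu>0(1)] measurable_Pair that measurable_ident_sets[OF refl])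
  define K where "K = (\<integral>X. X \<bullet> (X - A ** X ** A) \<partial>\<mu>0) +
    (\<integral>Y. Y \<bullet> (Y - matrix_inv A ** Y ** matrix_inv A) \<partial>\<mu>1)"
  define G where "G \<Gamma> = (\<integral>p. gap A (fst p) (snd p) \<partial>\<Gamma>)" for \<Gamma>
  note cc = coupling_cost[OF \<mu>0 \<mu>1 A, folded K_def G_def]
  have G0: "G \<Gamma> \<ge> 0" for \<Gamma>
    unfolding G_def by (intro Bochner_Integration.integral_nonneg gap_nonneg A)
  have GT: "G (plan T) = 0"
  proof -
    have g: "(\<lambda>p. gap A (fst p) (snd p)) \<in> borel_measurable (borel_spd \<Otimes>\<^sub>M borel_spd)"
      using cc(1)[OF plan(1)[OF Tmap]] by (simp add: plan_def borel_measurable_integrable)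
    have "gap A X (T X) = 0" for X by (simp add: gap_eq_0_iff[OF A] T_def)
    then show ?thesis unfolding G_def plan_def by (subst integral_distr[OF pm[OF Tm] g]) simp
  qed
  have K0: "K \<ge> 0" and KT: "(\<integral>\<^sup>+(X, Y). quad_cost X Y \<partial>plan T) = ennreal K"
    using cc(2,3)[OF plan(1)[OF Tmap]] GT by simp_all
  have lower: "ennreal K \<le> (\<integral>\<^sup>+(X, Y). quad_cost X Y \<partial>\<Gamma>)" if "\<Gamma> \<in> couplings \<mu>0 \<mu>1" for \<Gamma>
    using cc(2)[OF that] G0[of \<Gamma>] by (simp add: ennreal_leI)
  have kant: "kantorovich_cost quad_cost \<mu>0 \<mu>1 = ennreal K"
    unfolding kantorovich_cost_def
    by (rule antisym[OF INF_lower2[OF plan(1)[OF Tmap]] INF_greatest]) (use KT lower in auto)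
  have monge: "monge_cost quad_cost \<mu>0 \<mu>1 = ennreal K"
    unfolding monge_cost_def
  proof (rule antisym[OF INF_lower2[OF Tmap] INF_greatest])
    show "(\<integral>\<^sup>+X. quad_cost X (T X) \<partial>\<mu>0) \<le> ennreal K" using KT plan(2)[OF Tmap] by simp
    show "ennreal K \<le> (\<integral>\<^sup>+X. quad_cost X (S X) \<partial>\<mu>0)" if "S \<in> transport_maps \<mu>0 \<mu>1" for S
      using lower[OF plan(1)[OF that]] plan(2)[OF that] by simp
  qed
  have AE_opt: "AE p in \<Gamma>. snd p = T (fst p)"
    if \<Gamma>: "\<Gamma> \<in> couplings \<mu>0 \<mu>1" "(\<integral>\<^sup>+(X, Y). quad_cost X Y \<partial>\<Gamma>) = ennreal K" for \<Gamma>
  proof -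
    have "K + G \<Gamma> = K" using cc(2,3)[OF \<Gamma>(1)] \<Gamma>(2) K0 by simp
    then have "AE p in \<Gamma>. gap A (fst p) (snd p) = 0"
      using integral_nonneg_eq_0_iff_AE[OF cc(1)[OF \<Gamma>(1)]] by (simp add: G_def gap_nonneg[OF A])
    then show ?thesis by (simp add: gap_eq_0_iff[OF A] T_def)
  qed
  have uniq: "\<Gamma> = plan T"
    if \<Gamma>: "\<Gamma> \<in> couplings \<mu>0 \<mu>1" "(\<integral>\<^sup>+(X, Y). quad_cost X Y \<partial>\<Gamma>) = ennreal K" for \<Gamma>
  proof -
    note m = couplingsD[OF \<Gamma>(1)]
    have s: "sets \<Gamma> = sets (borel_spd \<Otimes>\<^sub>M borel_spd)" using \<Gamma>(1) by (simp add: couplings_def)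
    have mT: "(\<lambda>X. (X, T X)) \<in> borel_spd \<rightarrow>\<^sub>M borel_spd \<Otimes>\<^sub>M borel_spd"
      by (intro measurable_Pair Tm measurable_ident_sets[OF refl])
    have "plan T = distr (distr \<Gamma> borel_spd fst) (borel_spd \<Otimes>\<^sub>M borel_spd) (\<lambda>X. (X, T X))"
      by (simp add: plan_def m)
    also have "\<dots> = distr \<Gamma> (borel_spd \<Otimes>\<^sub>M borel_spd) (\<lambda>p. (fst p, T (fst p)))"
      by (simp add: distr_distr[OF mT m(1)] comp_def)
    also have "\<dots> = distr \<Gamma> (borel_spd \<Otimes>\<^sub>M borel_spd) (\<lambda>p. p)"
    proof (rule distr_cong_AE)
      show "AE p in \<Gamma>. (fst p, T (fst p)) = p"
        using AE_opt[OF \<Gamma>] by eventually_elim (auto simp: prod_eq_iff)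
      show "(\<lambda>p. (fst p, T (fst p))) \<in> \<Gamma> \<rightarrow>\<^sub>M borel_spd \<Otimes>\<^sub>M borel_spd"
        using measurable_compose[OF m(1) mT] .
      show "(\<lambda>p. p) \<in> \<Gamma> \<rightarrow>\<^sub>M borel_spd \<Otimes>\<^sub>M borel_spd" by (rule measurable_ident_sets[OF s])
    qed simp_all
    also have "\<dots> = \<Gamma>" by (rule distr_id2) (simp add: s)
    finally show ?thesis by simp
  qed
  show "unique_optimal_plan quad_cost \<mu>0 \<mu>1 (distr \<mu>0 (borel_spd \<Otimes>\<^sub>M borel_spd) (\<lambda>X. (X, T X)))"
    unfolding unique_optimal_plan_def optimal_plan_def kant plan_def[symmetric]
    using plan(1)[OF Tmap] KT by (auto intro: uniq)
  show "unique_optimal_monge_map quad_cost \<mu>0 \<mu>1 T"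
    unfolding unique_optimal_monge_map_def optimal_monge_map_def monge
  proof (intro conjI allI impI Tmap)
    show "(\<integral>\<^sup>+X. quad_cost X (T X) \<partial>\<mu>0) = ennreal K" using KT plan(2)[OF Tmap] by simp
    fix S assume S: "S \<in> transport_maps \<mu>0 \<mu>1 \<and> (\<integral>\<^sup>+X. quad_cost X (S X) \<partial>\<mu>0) = ennreal K"
    then have Sm: "S \<in> borel_spd \<rightarrow>\<^sub>M borel_spd" by (simp add: transport_maps_def)
    have "AE p in plan S. snd p = T (fst p)" using AE_opt[of "plan S"] plan[of S] S by simp
    from AE_distrD[OF pm[OF Sm] this[unfolded plan_def]] show "AE X in \<mu>0. S X = T X" by simp
  qed
  show "monge_cost quad_cost \<mu>0 \<mu>1 = kantorovich_cost quad_cost \<mu>0 \<mu>1" by (simp add: monge kant)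
  show "kantorovich_cost quad_cost \<mu>0 \<mu>1 = (\<integral>\<^sup>+X. quad_cost X (T X) \<partial>\<mu>0)"
    using KT plan(2)[OF Tmap] by (simp add: kant)
qed

section \<open>Second moments of spectrally invariant measures\<close>

lemma row_sandwich: "congr (\<chi> i. v i) X $ i $ j = v i \<bullet> (X *v v j)" for v :: "'n \<Rightarrow> real^'n"
proof -
  have "congr (\<chi> i. v i) X $ i $ j = (\<Sum>l\<in>UNIV. (\<Sum>k\<in>UNIV. v i $ k * X $ k $ l) * v j $ l)"
    by (simp add: congr_def matrix_matrix_mult_def transpose_def)
  also have "\<dots> = (\<Sum>k\<in>UNIV. \<Sum>l\<in>UNIV. v i $ k * X $ k $ l * v j $ l)"
    unfolding sum_distrib_right by (rule sum.swap)
  also have "\<dots> = v i \<bullet> (X *v v j)"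
    by (simp add: inner_vec_def matrix_vector_mult_def sum_distrib_left mult.assoc)
  finally show ?thesis .
qed

lemma component_product_bound: "\<bar>X $ i $ j * X $ k $ l\<bar> \<le> 1 * (norm X)\<^sup>2" for X :: "real^'n^'n"
proof -
  have "\<bar>X $ i $ j\<bar> \<le> norm X" for i j
    using component_le_norm_cart[of "X $ i" j] Finite_Cartesian_Product.norm_nth_le[of X i] by linarith
  then show ?thesis by (simp add: abs_mult power2_eq_square mult_mono)
qed

lemma measurable_component: "(\<lambda>X :: real^'n^'n. X $ i $ j) \<in> borel_measurable borel"
  by (intro borel_measurable_continuous_onI continuous_intros)

lemma integrable_component_product:
  assumes "borel_prob_spd \<mu>" "integrable \<mu> (\<lambda>X. (norm X)\<^sup>2)"
  shows "integrable \<mu> (\<lambda>X. X $ i $ j * X $ k $ l)"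
  by (rule integrable_quadratic_growth[OF assms _ component_product_bound])
    (intro borel_measurable_times measurable_component)

text \<open>
  The fourth-order tensor of second moments of the entries. Spectral invariance means that it may
  be computed in any orthonormal basis, and the lemmas below use this for special bases.
\<close>

definition entry_moment :: "(real^'n^'n) measure \<Rightarrow> 'n \<Rightarrow> 'n \<Rightarrow> 'n \<Rightarrow> 'n \<Rightarrow> real"
  where "entry_moment \<rho> i j k l = (\<integral>X. X $ i $ j * X $ k $ l \<partial>\<rho>)"

lemma entry_moment_orthonormal:
  fixes v :: "'n \<Rightarrow> real^'n"
  assumes \<rho>: "borel_prob_spd \<rho>" and inv: "spectrally_invariant \<rho>"
    and v: "\<And>k l. v k \<bullet> v l = (if k = l then 1 else 0)"
  shows "(\<integral>X. (v i \<bullet> (X *v v j)) * (v k \<bullet> (X *v v l)) \<partial>\<rho>) = entry_moment \<rho> i j k l"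
proof -
  \<comment> \<open>The rows of the orthogonal matrix are the new basis vectors.\<close>
  define Q where "Q = (\<chi> i. v i)"
  have Q: "orthogonal_matrix Q"
    by (simp add: Q_def orthogonal_matrix_orthonormal_rows row_def norm_eq_1 orthogonal_def v)
  then have i: "invertible Q" by (auto simp: orthogonal_matrix_def invertible_def)
  have "entry_moment \<rho> i j k l = (\<integral>X. X $ i $ j * X $ k $ l \<partial>distr \<rho> borel_spd (congr Q))"
    using inv Q by (simp add: entry_moment_def spectrally_invariant_def)
  also have "\<dots> = (\<integral>X. congr Q X $ i $ j * congr Q X $ k $ l \<partial>\<rho>)"
    by (rule integral_distr[OF measurable_prob_spd[OF \<rho> measurable_congr[OF i]]])
      (intro measurable_borel_spdI borel_measurable_times measurable_component)
  finally show ?thesis by (simp add: Q_def row_sandwich)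
qed

lemma axis_sandwich: "axis i 1 \<bullet> (X *v axis j 1) = X $ i $ j" for X :: "real^'n^'n"
  by (simp add: inner_axis' matrix_vector_mul_component inner_axis)

lemma inner_axis_axis_1: "axis i 1 \<bullet> (axis j 1 :: real^'n) = (if i = j then 1 else 0)"
  by (simp add: inner_axis_axis)

lemma entry_moment_permute:
  assumes "borel_prob_spd \<rho>" "spectrally_invariant \<rho>" "inj \<pi>"
  shows "entry_moment \<rho> (\<pi> i) (\<pi> j) (\<pi> k) (\<pi> l) = entry_moment \<rho> i j k l"
  using entry_moment_orthonormal[OF assms(1,2), of "\<lambda>k. axis (\<pi> k) 1" i j k l] assms(3)
  by (simp add: inner_axis_axis_1 axis_sandwich entry_moment_def inj_eq)

text \<open>
  Changing the sign of the basis vector \<open>p\<close> multiplies the moment by \<open>-1\<close> for each occurrence of \<open>p\<close>.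
\<close>

lemma entry_moment_reflect:
  assumes "borel_prob_spd \<rho>" "spectrally_invariant \<rho>"
  defines "s \<equiv> \<lambda>p q. if p = q then - 1 else 1 :: real"
  shows "s p i * s p j * s p k * s p l * entry_moment \<rho> i j k l = entry_moment \<rho> i j k l"
proof -
  have "(\<integral>X. (s p i * s p j * s p k * s p l) * (X $ i $ j * X $ k $ l) \<partial>\<rho>) = entry_moment \<rho> i j k l"
    using entry_moment_orthonormal[OF assms(1,2), of "\<lambda>k. s p k *\<^sub>R axis k 1" i j k l]
    by (simp add: inner_axis_axis_1 axis_sandwich matrix_vector_mult_scaleR mult_ac s_def)
  then show ?thesis by (simp add: entry_moment_def)
qed

text \<open>
  If the four indices do not match up in pairs, one of them occurs an odd number of times, and
  reflecting its basis vector changes the sign of the moment.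
\<close>

lemma entry_moment_odd_eq_0:
  assumes "borel_prob_spd \<rho>" "spectrally_invariant \<rho>"
    and "\<not> (i = j \<and> k = l)" "\<not> (i = k \<and> j = l)" "\<not> (i = l \<and> j = k)"
  shows "entry_moment \<rho> i j k l = 0"
  using entry_moment_reflect[OF assms(1,2), of i i j k l] entry_moment_reflect[OF assms(1,2), of j i j k l]
    entry_moment_reflect[OF assms(1,2), of k i j k l] entry_moment_reflect[OF assms(1,2), of l i j k l] assms(3-)
  by (auto split: if_splits)

text \<open>
  Two transpositions suffice: the second one corrects the image of \<open>j\<close> and leaves \<open>i'\<close> alone, because
  neither of the two points that it exchanges is \<open>i'\<close>.
\<close>

lemma ex_inj_two_points:
  fixes i j i' j' :: 'n
  assumes "i \<noteq> j" "i' \<noteq> j'"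
  shows "\<exists>\<pi> :: 'n \<Rightarrow> 'n. inj \<pi> \<and> \<pi> i = i' \<and> \<pi> j = j'"
proof -
  let ?j = "Transposition.transpose i i' j"
  let ?\<pi> = "Transposition.transpose ?j j' \<circ> Transposition.transpose i i'"
  have "?j \<noteq> i'" using assms by (auto simp: Transposition.transpose_def)
  then have "?\<pi> i = i'" "?\<pi> j = j'" using assms by simp_all
  moreover have "inj ?\<pi>" by (intro inj_compose inj_transpose)
  ultimately show ?thesis by blast
qed

text \<open>
  The general form of an orthogonally invariant tensor with the symmetries of \<open>X \<otimes> X\<close>.
\<close>

definition isotropic_moments :: "(real^'n^'n) measure \<Rightarrow> real \<Rightarrow> real \<Rightarrow> bool"
  where "isotropic_moments \<rho> a b \<longleftrightarrow> (\<forall>i j k l. entry_moment \<rho> i j k l =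
    a * of_bool (i = j \<and> k = l) + b * (of_bool (i = k \<and> j = l) + of_bool (i = l \<and> j = k)))"

lemma entry_moment_sym:
  assumes "borel_prob_spd \<rho>"
  shows "entry_moment \<rho> i j k l = entry_moment \<rho> i j l k"
  unfolding entry_moment_def
  by (intro Bochner_Integration.integral_cong refl)
    (use assms in \<open>auto simp: borel_prob_spdD(3) spd_def Sym_iff\<close>)

text \<open>
  Reflections leave three kinds of nonzero moments, and permutations make each kind constant:
  \<open>\<alpha> = E[X\<^sub>p\<^sub>p\<^sup>2]\<close>, \<open>\<beta> = E[X\<^sub>p\<^sub>q\<^sup>2]\<close> and \<open>\<gamma> = E[X\<^sub>p\<^sub>p X\<^sub>q\<^sub>q]\<close>. These satisfy one linear relation, which makes
  \<open>a = \<gamma>\<close> and \<open>b = \<beta>\<close> account for the case of four equal indices as well.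
\<close>

lemma isotropic_moments_exist:
  fixes \<rho> :: "(real^'n^'n) measure"
  assumes \<rho>: "borel_prob_spd \<rho>" and inv: "spectrally_invariant \<rho>"
    and int: "integrable \<rho> (\<lambda>X. (norm X)\<^sup>2)" and d: "CARD('n) \<ge> 2"
  shows "\<exists>a b. isotropic_moments \<rho> a b"
proof -
  obtain p q :: 'n where pq: "p \<noteq> q"
    using d by (metis card_2_iff' ex_card UNIV_I subset_UNIV)
  let ?m = "entry_moment \<rho>"
  define \<alpha> \<beta> \<gamma> where "\<alpha> = ?m p p p p" and "\<beta> = ?m p q p q" and "\<gamma> = ?m p p q q"
  have \<alpha>: "?m i i i i = \<alpha>" for i
    using entry_moment_permute[OF \<rho> inv inj_transpose[of p i], of p p p p] by (simp add: \<alpha>_def)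
  have off: "?m i j i j = \<beta>" "?m i i j j = \<gamma>" if "i \<noteq> j" for i j
  proof -
    obtain \<pi> where "inj \<pi>" "\<pi> p = i" "\<pi> q = j" using ex_inj_two_points[OF pq \<open>i \<noteq> j\<close>] by blast
    then show "?m i j i j = \<beta>" "?m i i j j = \<gamma>"
      using entry_moment_permute[OF \<rho> inv, of \<pi> p q p q] entry_moment_permute[OF \<rho> inv, of \<pi> p p q q]
      by (simp_all add: \<beta>_def \<gamma>_def)
  qed
  have rel: "\<gamma> = \<alpha> - 2 * \<beta>"
  proof -
    \<comment> \<open>With the basis vectors \<open>p\<close> and \<open>q\<close> replaced by their normalized sum and difference, the
      off-diagonal entry of \<open>X\<close> is \<open>(X\<^sub>p\<^sub>p - X\<^sub>q\<^sub>q) / 2\<close>, hence \<open>\<beta> = (2 \<alpha> - 2 \<gamma>) / 4\<close>.\<close>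
    define v :: "'n \<Rightarrow> real^'n" where "v k = (if k = p then (1 / sqrt 2) *\<^sub>R (axis p 1 + axis q 1)
      else if k = q then (1 / sqrt 2) *\<^sub>R (axis p 1 - axis q 1) else axis k 1)" for k
    have v: "v k \<bullet> v l = (if k = l then 1 else 0)" for k l
      using pq by (simp add: v_def inner_axis_axis_1 inner_add inner_diff)
    have vpq: "v p \<bullet> (X *v v q) = (X $ p $ p - X $ q $ q) / 2" if "X \<in> spd" for X
    proof -
      have "X $ q $ p = X $ p $ q" using that by (simp add: spd_def Sym_iff)
      then show ?thesis using pq
        by (simp add: v_def matrix_vector_mult_scaleR matrix_vector_mult_diff_distrib inner_add_left
            inner_diff_right axis_sandwich diff_divide_distrib add_divide_distrib)
    qed
    have "\<beta> = (\<integral>X. ((X $ p $ p - X $ q $ q) / 2) * ((X $ p $ p - X $ q $ q) / 2) \<partial>\<rho>)"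
      unfolding \<beta>_def entry_moment_orthonormal[OF \<rho> inv, of v p q p q, OF v, symmetric]
      by (intro Bochner_Integration.integral_cong refl) (simp add: borel_prob_spdD(3)[OF \<rho>] vpq)
    also have "\<dots> = (\<integral>X. (X $ p $ p * X $ p $ p + X $ q $ q * X $ q $ q - 2 * (X $ p $ p * X $ q $ q)) / 4 \<partial>\<rho>)"
      by (intro Bochner_Integration.integral_cong refl) (simp add: field_simps)
    also have "\<dots> = (\<alpha> + \<alpha> - 2 * \<gamma>) / 4"
      using integrable_component_product[OF \<rho> int] \<alpha>[of q]
      by (simp add: \<alpha>_def \<gamma>_def entry_moment_def)
    finally show ?thesis by simp
  qed
  have "?m i j k l = \<gamma> * of_bool (i = j \<and> k = l) + \<beta> * (of_bool (i = k \<and> j = l) + of_bool (i = l \<and> j = k))"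
    for i j k l
  proof -
    consider "i = j" "k = l" "i = k" | "i = j" "k = l" "i \<noteq> k" | "i = k" "j = l" "i \<noteq> j"
      | "i = l" "j = k" "i \<noteq> j" | "\<not> (i = j \<and> k = l)" "\<not> (i = k \<and> j = l)" "\<not> (i = l \<and> j = k)"
      by blast
    then show ?thesis
    proof cases
      case 1 then show ?thesis using \<alpha>[of i] rel by simp
    next
      case 2 then show ?thesis using off(2)[of i k] by simp
    next
      case 3 then show ?thesis using off(1)[of i j] by simp
    next
      case 4 then show ?thesis using off(1)[of i j] entry_moment_sym[OF \<rho>, of i j j i] by simp
    next
      case 5
      then have "of_bool (i = j \<and> k = l) = (0 :: real)" "of_bool (i = k \<and> j = l) = (0 :: real)"
        "of_bool (i = l \<and> j = k) = (0 :: real)"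
        by (simp_all only: of_bool_eq_0_iff not_False_eq_True)
      then show ?thesis by (simp only: entry_moment_odd_eq_0[OF \<rho> inv 5] mult_zero_right add_0_left)
    qed
  qed
  then show ?thesis unfolding isotropic_moments_def by blast
qed

section \<open>Quadratic forms under isotropic moments\<close>

lemma inner_self_eq_sum: "P \<bullet> P = (\<Sum>i\<in>UNIV. \<Sum>j\<in>UNIV. P $ i $ j * P $ i $ j)" for P :: "real^'n^'n"
  by (simp add: inner_vec_def)

lemma inner_sandwich_eq_sum:
  "X \<bullet> (P ** X ** P) = (\<Sum>i\<in>UNIV. \<Sum>j\<in>UNIV. \<Sum>l\<in>UNIV. \<Sum>k\<in>UNIV. P $ i $ k * P $ l $ j * (X $ i $ j * X $ k $ l))"
  for X P :: "real^'n^'n"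
  by (simp add: inner_vec_def matrix_matrix_mult_def sum_distrib_left sum_distrib_right mult_ac)

lemma isotropic_quadratic_form:
  fixes P :: "real^'n^'n"
  assumes \<rho>: "borel_prob_spd \<rho>" and int: "integrable \<rho> (\<lambda>X. (norm X)\<^sup>2)"
    and iso: "isotropic_moments \<rho> a b" and P: "transpose P = P"
  shows "(\<integral>X. X \<bullet> (P ** X ** P) \<partial>\<rho>) = (a + b) * (P \<bullet> P) + b * (trace P)\<^sup>2"
proof -
  have sym: "P $ i $ j = P $ j $ i" for i j
    using P Sym_iff[of P] by (simp add: Sym_def)
  have "(\<integral>X. X \<bullet> (P ** X ** P) \<partial>\<rho>) =
      (\<Sum>i\<in>UNIV. \<Sum>j\<in>UNIV. \<Sum>l\<in>UNIV. \<Sum>k\<in>UNIV. P $ i $ k * P $ l $ j * entry_moment \<rho> i j k l)"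
    unfolding inner_sandwich_eq_sum entry_moment_def
    by (simp add: integrable_component_product[OF \<rho> int])
  also have "\<dots> = (\<Sum>i\<in>UNIV. \<Sum>j\<in>UNIV. \<Sum>l\<in>UNIV. \<Sum>k\<in>UNIV.
      (if l = k then if i = j then a * (P $ i $ k * P $ l $ j) else 0 else 0) +
      (if k = i then if l = j then b * (P $ i $ k * P $ l $ j) else 0 else 0) +
      (if k = j then if l = i then b * (P $ i $ k * P $ l $ j) else 0 else 0))"
    using iso unfolding isotropic_moments_def
    by (intro sum.cong refl) (auto simp: algebra_simps)
  also have "\<dots> = (\<Sum>i\<in>UNIV. \<Sum>l\<in>UNIV. a * (P $ i $ l * P $ l $ i)) +
      (\<Sum>i\<in>UNIV. \<Sum>j\<in>UNIV. b * (P $ i $ i * P $ j $ j)) +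
      (\<Sum>i\<in>UNIV. \<Sum>j\<in>UNIV. b * (P $ i $ j * P $ i $ j))"
  proof -
    have "(\<Sum>j\<in>UNIV. \<Sum>l\<in>UNIV. \<Sum>k\<in>UNIV.
      (if l = k then if i = j then a * (P $ i $ k * P $ l $ j) else 0 else 0)) =
      (\<Sum>l\<in>UNIV. a * (P $ i $ l * P $ l $ i))" for i
      by (subst sum.swap) simp
    then show ?thesis by (simp add: sum.distrib)
  qed
  also have "(\<Sum>i\<in>UNIV. \<Sum>l\<in>UNIV. a * (P $ i $ l * P $ l $ i)) = a * (P \<bullet> P)"
    unfolding inner_self_eq_sum sum_distrib_left by (intro sum.cong refl, subst sym, rule refl)
  also have "(\<Sum>i\<in>UNIV. \<Sum>j\<in>UNIV. b * (P $ i $ i * P $ j $ j)) = b * (trace P)\<^sup>2"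
    unfolding trace_def power2_eq_square sum_product by (simp add: sum_distrib_left)
  also have "(\<Sum>i\<in>UNIV. \<Sum>j\<in>UNIV. b * (P $ i $ j * P $ i $ j)) = b * (P \<bullet> P)"
    unfolding inner_self_eq_sum sum_distrib_left ..
  finally show ?thesis by (simp add: algebra_simps)
qed

lemma isotropic_trace_square:
  fixes \<rho> :: "(real^'n^'n) measure"
  assumes \<rho>: "borel_prob_spd \<rho>" and int: "integrable \<rho> (\<lambda>X. (norm X)\<^sup>2)"
    and iso: "isotropic_moments \<rho> a b"
  shows "(\<integral>X. (trace X)\<^sup>2 \<partial>\<rho>) = a * (real CARD('n))\<^sup>2 + 2 * b * real CARD('n)"
proof -
  have "(\<integral>X. (trace X)\<^sup>2 \<partial>\<rho>) = (\<Sum>i\<in>UNIV. \<Sum>k\<in>UNIV. entry_moment \<rho> i i k k)"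
    unfolding trace_def power2_eq_square sum_product entry_moment_def
    by (simp add: integrable_component_product[OF \<rho> int])
  also have "\<dots> = (\<Sum>i\<in>UNIV. \<Sum>k\<in>(UNIV :: 'n set). a + (if i = k then 2 * b else 0))"
    using iso unfolding isotropic_moments_def by (intro sum.cong refl) auto
  also have "\<dots> = a * (real CARD('n))\<^sup>2 + 2 * b * real CARD('n)"
    by (simp add: sum.distrib power2_eq_square algebra_simps)
  finally show ?thesis .
qed

lemma isotropic_square_trace:
  fixes \<rho> :: "(real^'n^'n) measure"
  assumes \<rho>: "borel_prob_spd \<rho>" and int: "integrable \<rho> (\<lambda>X. (norm X)\<^sup>2)"
    and iso: "isotropic_moments \<rho> a b"
  shows "(\<integral>X. trace (X ** X) \<partial>\<rho>) = (a + b) * real CARD('n) + b * (real CARD('n))\<^sup>2"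
proof -
  have "(\<integral>X. trace (X ** X) \<partial>\<rho>) = (\<integral>X. X \<bullet> (mat 1 ** X ** mat 1) \<partial>\<rho>)"
    by (intro Bochner_Integration.integral_cong refl)
      (use borel_prob_spdD(3)[OF \<rho>] in \<open>auto simp: inner_eq_trace spd_sym\<close>)
  also have "\<dots> = (a + b) * ((mat 1 :: real^'n^'n) \<bullet> mat 1) + b * (trace (mat 1 :: real^'n^'n))\<^sup>2"
    by (rule isotropic_quadratic_form[OF \<rho> int iso]) simp
  finally show ?thesis by (simp add: inner_eq_trace trace_I)
qed

text \<open>
  The moments of \<open>Tr X\<close> and \<open>Tr (X\<^sup>2)\<close> form a linear system for \<open>a\<close> and \<open>b\<close> with determinant proportional
  to \<open>d\<^sup>2 + d - 2 = (d - 1) (d + 2)\<close>, which is nonzero exactly in dimension at least 2.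
\<close>

lemma isotropic_coeffs:
  fixes \<rho> :: "(real^'n^'n) measure"
  assumes \<rho>: "borel_prob_spd \<rho>" and int: "integrable \<rho> (\<lambda>X. (norm X)\<^sup>2)"
    and iso: "isotropic_moments \<rho> a b" and d: "CARD('n) \<ge> 2"
  shows "b_coeff \<rho> = b" "a_coeff \<rho> = a"
proof -
  let ?d = "real CARD('n)"
  have d2: "?d \<ge> 2" using d by simp
  then have "?d * ?d \<ge> 2 * 2" by (intro mult_mono) auto
  then have "?d\<^sup>2 + ?d - 2 \<noteq> 0" using d2 by (simp add: power2_eq_square)
  moreover have "(a + b) * ?d + b * ?d\<^sup>2 - 1 / ?d * (a * ?d\<^sup>2 + 2 * b * ?d) = b * (?d\<^sup>2 + ?d - 2)"
    using d2 by (simp add: field_simps power2_eq_square)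
  ultimately show b: "b_coeff \<rho> = b"
    unfolding b_coeff_def isotropic_trace_square[OF \<rho> int iso] isotropic_square_trace[OF \<rho> int iso]
    by simp
  show "a_coeff \<rho> = a"
    unfolding a_coeff_def b isotropic_trace_square[OF \<rho> int iso] using d2 by simp
qed

lemma UNIV_singleton: "CARD('n) = 1 \<Longrightarrow> \<exists>i :: 'n. UNIV = {i}"
  by (simp add: card_1_singleton_iff)

text \<open>
  With a single index all three terms of the isotropic tensor coincide, so only \<open>a + 2 b\<close> is determined.
\<close>

lemma isotropic_moments_dim_1:
  fixes \<rho> :: "(real^'n^'n) measure"
  assumes d: "CARD('n) = 1" and ab: "a + 2 * b = (\<integral>X. trace (X ** X) \<partial>\<rho>)"
  shows "isotropic_moments \<rho> a b"
proof -
  obtain p :: 'n where p: "UNIV = {p}" using UNIV_singleton[OF d] by blast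
  then have eq: "i = p" for i by blast
  have "trace (X ** X) = X $ p $ p * X $ p $ p" for X :: "real^'n^'n"
    by (simp add: trace_def matrix_matrix_mult_def p)
  then have "entry_moment \<rho> p p p p = a + 2 * b" using ab by (simp add: entry_moment_def)
  moreover have "entry_moment \<rho> i j k l = entry_moment \<rho> p p p p" for i j k l
    by (subst eq[of i], subst eq[of j], subst eq[of k], subst eq[of l], rule refl)
  moreover have "i = j" for i j :: 'n by (subst eq[of i], subst eq[of j], rule refl)
  ultimately show ?thesis unfolding isotropic_moments_def by simp
qed

lemma inner_dim_1:
  fixes X Y :: "real^'n^'n"
  assumes d: "CARD('n) = 1" shows "X \<bullet> Y = trace X * trace Y"
proof -
  obtain p :: 'n where p: "UNIV = {p}" using UNIV_singleton[OF d] by blast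
  show ?thesis by (simp add: trace_def inner_vec_def p)
qed

section \<open>Transport between congruence images\<close>

text \<open>
  By construction \<open>A \<Sigma>0 A = S0\<^sup>-\<^sup>1 C\<^sup>2 S0\<^sup>-\<^sup>1 = \<Sigma>1\<close>. So \<open>A S0\<close> and \<open>S1\<close> are two factors \<open>F\<close> of \<open>\<Sigma>1 = F F\<^sup>T\<close>,
  and two such factors differ by an orthogonal matrix.
\<close>

lemma congruence_factor_orthogonal:
  fixes \<Sigma>0 \<Sigma>1 :: "real^'n^'n"
  assumes \<Sigma>: "\<Sigma>0 \<in> spd" "\<Sigma>1 \<in> spd"
  defines "S0 \<equiv> spd_sqrt \<Sigma>0" and "S1 \<equiv> spd_sqrt \<Sigma>1"
  defines "C \<equiv> spd_sqrt (S0 ** \<Sigma>1 ** S0)"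
  defines "A \<equiv> matrix_inv S0 ** C ** matrix_inv S0"
  shows "A \<in> spd" "S0 ** A ** S0 = C" "C \<in> spd" "C ** C = S0 ** \<Sigma>1 ** S0"
    and "orthogonal_matrix (matrix_inv S1 ** A ** S0)" "S1 ** (matrix_inv S1 ** A ** S0) = A ** S0"
proof -
  have S: "S0 \<in> spd" "S1 \<in> spd" "S0 ** S0 = \<Sigma>0" "S1 ** S1 = \<Sigma>1"
    using \<Sigma> by (simp_all add: S0_def S1_def spd_sqrt_spd spd_sqrt_mult)
  let ?R0 = "matrix_inv S0" and ?R1 = "matrix_inv S1"
  note inv0 = matrix_inv_left[OF spd_invertible[OF S(1)]] matrix_inv_right[OF spd_invertible[OF S(1)]]
  note inv1 = matrix_inv_left[OF spd_invertible[OF S(2)]] matrix_inv_right[OF spd_invertible[OF S(2)]]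
  have "S0 ** \<Sigma>1 ** S0 \<in> spd"
    using congr_spd[OF spd_invertible[OF S(1)] \<Sigma>(2)] by (simp add: congr_def spd_sym[OF S(1)])
  then show C: "C \<in> spd" and CC: "C ** C = S0 ** \<Sigma>1 ** S0"
    by (simp_all add: C_def spd_sqrt_spd spd_sqrt_mult)
  have R: "?R0 \<in> spd" "?R1 \<in> spd" using S by (simp_all add: spd_inv)
  show A: "A \<in> spd"
    using congr_spd[OF spd_invertible[OF R(1)] C] by (simp add: congr_def spd_sym[OF R(1)] A_def)
  have "S0 ** A ** S0 = (S0 ** ?R0) ** C ** (?R0 ** S0)" by (simp add: A_def matrix_mul_assoc)
  then show "S0 ** A ** S0 = C" by (simp add: inv0)
  let ?Q = "?R1 ** A ** S0"
  have "S1 ** ?Q = (S1 ** ?R1) ** A ** S0" by (simp add: matrix_mul_assoc)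
  then show "S1 ** ?Q = A ** S0" by (simp add: inv1)
  have "A ** \<Sigma>0 ** A = ?R0 ** (C ** ((?R0 ** S0) ** ((S0 ** ?R0) ** C))) ** ?R0"
    by (simp add: A_def matrix_mul_assoc flip: S(3))
  also have "\<dots> = ?R0 ** (S0 ** \<Sigma>1 ** S0) ** ?R0"
    by (simp only: inv0 matrix_mul_lid CC)
  also have "\<dots> = (?R0 ** S0) ** \<Sigma>1 ** (S0 ** ?R0)"
    by (simp only: matrix_mul_assoc)
  finally have A\<Sigma>A: "A ** \<Sigma>0 ** A = \<Sigma>1" by (simp add: inv0)
  have "?Q ** transpose ?Q = ?R1 ** (A ** \<Sigma>0 ** A) ** ?R1"
    by (simp add: matrix_transpose_mul spd_sym[OF A] spd_sym[OF R(2)] spd_sym[OF S(1)] matrix_mul_assoc flip: S(3))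
  also have "\<dots> = (?R1 ** S1) ** (S1 ** ?R1)"
    unfolding A\<Sigma>A by (simp add: matrix_mul_assoc flip: S(4))
  finally have "?Q ** transpose ?Q = mat 1" by (simp add: inv1)
  then have "orthogonal_matrix (transpose ?Q)" by (simp add: orthogonal_matrix)
  then show "orthogonal_matrix ?Q" by simp
qed

lemma integral_distr_congr:
  fixes f :: "real^'n^'n \<Rightarrow> real"
  assumes "borel_prob_spd \<rho>" "invertible B" "f \<in> borel_measurable borel"
  shows "(\<integral>X. f X \<partial>distr \<rho> borel_spd (congr B)) = (\<integral>X. f (congr B X) \<partial>\<rho>)"
    and "integrable (distr \<rho> borel_spd (congr B)) f \<longleftrightarrow> integrable \<rho> (\<lambda>X. f (congr B X))"
proof -
  note m = measurable_prob_spd[OF assms(1) measurable_congr[OF assms(2)]]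
    and f = measurable_borel_spdI[OF assms(3)]
  show "(\<integral>X. f X \<partial>distr \<rho> borel_spd (congr B)) = (\<integral>X. f (congr B X) \<partial>\<rho>)"
    by (rule integral_distr[OF m f])
  show "integrable (distr \<rho> borel_spd (congr B)) f \<longleftrightarrow> integrable \<rho> (\<lambda>X. f (congr B X))"
    by (rule integrable_distr_eq[OF m f])
qed

lemma second_moment_congr:
  fixes B :: "real^'n^'n"
  assumes \<rho>: "borel_prob_spd \<rho>" and int: "integrable \<rho> (\<lambda>X. (norm X)\<^sup>2)" and B: "invertible B"
  shows "integrable (distr \<rho> borel_spd (congr B)) (\<lambda>X. (norm X)\<^sup>2)"
proof -
  obtain c where c: "\<And>X. norm (B ** X ** transpose B) \<le> c * norm X" using sandwich_bound by blast
  have m: "(\<lambda>X. (norm (congr B X))\<^sup>2) \<in> borel_measurable borel"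
    unfolding congr_def
    by (intro borel_measurable_power measurable_compose[OF measurable_sandwich borel_measurable_norm])
  have "\<bar>(norm (congr B X))\<^sup>2\<bar> \<le> c\<^sup>2 * (norm X)\<^sup>2" for X
    using power_mono[OF c norm_ge_zero, of X 2] by (simp add: congr_def power_mult_distrib)
  then have "integrable \<rho> (\<lambda>X. (norm (congr B X))\<^sup>2)"
    by (rule integrable_quadratic_growth[OF \<rho> int m])
  then show ?thesis
    by (subst integral_distr_congr(2)[OF \<rho> B]) simp_all
qed

text \<open>
  Moving the outer factors across the inner product, \<open>\<parallel>S X S\<parallel>\<^sup>2 = \<langle>X, S\<^sup>2 X S\<^sup>2\<rangle>\<close>.
\<close>

lemma isotropic_second_moment_congr:
  fixes S :: "real^'n^'n"
  assumes \<rho>: "borel_prob_spd \<rho>" and int: "integrable \<rho> (\<lambda>X. (norm X)\<^sup>2)"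
    and iso: "isotropic_moments \<rho> a b" and S: "S \<in> spd"
  shows "(\<integral>X. (norm X)\<^sup>2 \<partial>distr \<rho> borel_spd (congr S)) =
    (a + b) * ((S ** S) \<bullet> (S ** S)) + b * (trace (S ** S))\<^sup>2"
proof -
  have *: "(norm (congr S X))\<^sup>2 = X \<bullet> ((S ** S) ** X ** (S ** S))" for X
    unfolding power2_norm_eq_inner congr_def spd_sym[OF S]
    by (simp only: inner_mult_right[of "S ** X" S] inner_mult_left[of S X] spd_sym[OF S] matrix_mul_assoc)
  have "(\<integral>X. (norm X)\<^sup>2 \<partial>distr \<rho> borel_spd (congr S)) = (\<integral>X. (norm (congr S X))\<^sup>2 \<partial>\<rho>)"
    by (rule integral_distr_congr(1)[OF \<rho> spd_invertible[OF S]]) simp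
  also have "\<dots> = (a + b) * ((S ** S) \<bullet> (S ** S)) + b * (trace (S ** S))\<^sup>2"
    unfolding * by (rule isotropic_quadratic_form[OF \<rho> int iso]) (simp add: matrix_transpose_mul spd_sym[OF S])
  finally show ?thesis .
qed

text \<open>
  For the optimal \<open>A\<close> the matrix \<open>S A S\<close> is the square root \<open>C\<close> of the cost formula.
\<close>

lemma isotropic_cross_moment_congr:
  fixes S A :: "real^'n^'n"
  assumes \<rho>: "borel_prob_spd \<rho>" and int: "integrable \<rho> (\<lambda>X. (norm X)\<^sup>2)"
    and iso: "isotropic_moments \<rho> a b" and S: "S \<in> spd" and A: "A \<in> spd"
  defines "C \<equiv> S ** A ** S"
  shows "(\<integral>X. X \<bullet> (A ** X ** A) \<partial>distr \<rho> borel_spd (congr S)) = (a + b) * (C \<bullet> C) + b * (trace C)\<^sup>2"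
proof -
  have *: "congr S X \<bullet> (A ** congr S X ** A) = X \<bullet> (C ** X ** C)" for X
    unfolding congr_def spd_sym[OF S] C_def
    by (simp only: inner_mult_right[of "S ** X" S] inner_mult_left[of S X] spd_sym[OF S] matrix_mul_assoc)
  have "(\<integral>X. X \<bullet> (A ** X ** A) \<partial>distr \<rho> borel_spd (congr S)) = (\<integral>X. congr S X \<bullet> (A ** congr S X ** A) \<partial>\<rho>)"
    by (rule integral_distr_congr(1)[OF \<rho> spd_invertible[OF S]])
      (intro borel_measurable_inner measurable_sandwich measurable_ident_sets refl)
  also have "\<dots> = (a + b) * (C \<bullet> C) + b * (trace C)\<^sup>2"
    unfolding * by (rule isotropic_quadratic_form[OF \<rho> int iso])
      (simp add: C_def matrix_transpose_mul spd_sym[OF S] spd_sym[OF A] matrix_mul_assoc)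
  finally show ?thesis .
qed

lemma inner_spd_sqrt_cross:
  fixes \<Sigma>0 \<Sigma>1 C :: "real^'n^'n"
  assumes "\<Sigma>0 \<in> spd" "\<Sigma>1 \<in> spd" "C \<in> spd" "C ** C = spd_sqrt \<Sigma>0 ** \<Sigma>1 ** spd_sqrt \<Sigma>0"
  shows "C \<bullet> C = \<Sigma>0 \<bullet> \<Sigma>1"
proof -
  have "C \<bullet> C = trace (spd_sqrt \<Sigma>0 ** (\<Sigma>1 ** spd_sqrt \<Sigma>0))"
    using assms by (simp add: inner_eq_trace spd_sym matrix_mul_assoc)
  also have "\<dots> = trace (\<Sigma>1 ** spd_sqrt \<Sigma>0 ** spd_sqrt \<Sigma>0)" by (rule trace_mul_sym)
  also have "\<dots> = \<Sigma>1 \<bullet> \<Sigma>0"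
    using assms by (simp add: inner_eq_trace spd_sym spd_sqrt_mult flip: matrix_mul_assoc)
  finally show ?thesis by (simp add: inner_commute)
qed

theorem theorem5p1:
  fixes \<rho> \<mu>0 \<mu>1 :: "(real^'n^'n) measure"
    and \<Sigma>0 \<Sigma>1 C A :: "real^'n^'n"
    and T :: "real^'n^'n \<Rightarrow> real^'n^'n"
  assumes "borel_prob_spd \<rho>"
    and "abs_cont_spd \<rho>"
    and "spectrally_invariant \<rho>"
    and "integrable \<rho> (\<lambda>X. (norm X)\<^sup>2)"
    and "\<Sigma>0 \<in> spd" and "\<Sigma>1 \<in> spd"
    and "\<mu>0 = distr \<rho> borel_spd (congr (spd_sqrt \<Sigma>0))"
    and "\<mu>1 = distr \<rho> borel_spd (congr (spd_sqrt \<Sigma>1))"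
    and "C = spd_sqrt (spd_sqrt \<Sigma>0 ** \<Sigma>1 ** spd_sqrt \<Sigma>0)"
    and "A = matrix_inv (spd_sqrt \<Sigma>0) **
             spd_sqrt (spd_sqrt \<Sigma>0 ** \<Sigma>1 ** spd_sqrt \<Sigma>0) **
             matrix_inv (spd_sqrt \<Sigma>0)"
    and "T = (\<lambda>X. A ** X ** A)"
  shows
    "(A \<in> spd \<and> unique_optimal_monge_map quad_cost \<mu>0 \<mu>1 T) \<and>
     unique_optimal_plan quad_cost \<mu>0 \<mu>1
       (distr \<mu>0 (borel_spd \<Otimes>\<^sub>M borel_spd) (\<lambda>X. (X, T X))) \<and>
     ((CARD('n) \<ge> 2 \<longrightarrow>
         enn2ereal (kantorovich_cost quad_cost \<mu>0 \<mu>1) =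
         ereal (cost_formula (a_coeff \<rho>) (b_coeff \<rho>) \<Sigma>0 \<Sigma>1 C)) \<and>
      (CARD('n) = 1 \<longrightarrow>
         (\<forall>a b. a + 2 * b = (\<integral>X. trace (X ** X) \<partial>\<rho>) \<longrightarrow>
            enn2ereal (kantorovich_cost quad_cost \<mu>0 \<mu>1) =
            ereal (cost_formula a b \<Sigma>0 \<Sigma>1 C)) \<and>
         (\<forall>a b a' b'. a + 2 * b = a' + 2 * b' \<longrightarrow>
            cost_formula a b \<Sigma>0 \<Sigma>1 C = cost_formula a' b' \<Sigma>0 \<Sigma>1 C))) \<and>
     monge_cost quad_cost \<mu>0 \<mu>1 = kantorovich_cost quad_cost \<mu>0 \<mu>1 \<and>
     kantorovich_cost quad_cost \<mu>0 \<mu>1 = J_cost quad_cost \<rho> (spd_sqrt \<Sigma>0) (spd_sqrt \<Sigma>1)"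
proof -
  note \<rho> = assms(1) and inv = assms(3) and int = assms(4) and \<Sigma> = assms(5,6)
  let ?S0 = "spd_sqrt \<Sigma>0" and ?S1 = "spd_sqrt \<Sigma>1"
  let ?Q = "matrix_inv ?S1 ** A ** ?S0"
  have S: "?S0 \<in> spd" "?S1 \<in> spd" "?S0 ** ?S0 = \<Sigma>0" "?S1 ** ?S1 = \<Sigma>1"
    using \<Sigma> by (simp_all add: spd_sqrt_spd spd_sqrt_mult)
  note Si = spd_invertible[OF S(1)] spd_invertible[OF S(2)]
  note fac = congruence_factor_orthogonal[OF \<Sigma>, folded assms(9,10), folded assms(9)]
  have A: "A \<in> spd" using fac(1) unfolding assms(9,10) .
  have C: "?S0 ** A ** ?S0 = C" "C \<in> spd" "C ** C = ?S0 ** \<Sigma>1 ** ?S0"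
    using fac(2-4) unfolding assms(9,10) .
  have Q: "orthogonal_matrix ?Q" "?S1 ** ?Q = A ** ?S0" using fac(5,6) unfolding assms(9,10) .
  have Qi: "invertible ?Q" using Q(1) by (auto simp: orthogonal_matrix_def invertible_def)
  have Q\<rho>: "distr \<rho> borel_spd (congr ?Q) = \<rho>" using inv Q(1) by (simp add: spectrally_invariant_def)
  have \<mu>0: "borel_prob_spd \<mu>0" and \<mu>1: "borel_prob_spd \<mu>1"
    unfolding assms(7,8) by (intro borel_prob_spd_distr \<rho> measurable_congr Si)+
  have int0: "integrable \<mu>0 (\<lambda>X. (norm X)\<^sup>2)" and int1: "integrable \<mu>1 (\<lambda>X. (norm X)\<^sup>2)"
    unfolding assms(7,8) by (intro second_moment_congr \<rho> int Si)+
  have T: "T = congr A" by (simp add: assms(11) congr_def[abs_def] spd_sym[OF A])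
  have T_S0: "T (congr ?S0 X) = congr (?S1 ** ?Q) X" for X by (simp add: T congr_congr Q)
  have Tm: "T \<in> borel_spd \<rightarrow>\<^sub>M borel_spd"
    unfolding T by (rule measurable_congr[OF spd_invertible[OF A]])
  \<comment> \<open>Composing with an element of the stabilizer does not change the image measure. This is applied to
    \<open>Q\<close> for the optimal map, and to arbitrary elements for the orbit cost.\<close>
  have push: "distr \<rho> borel_spd (congr (?S1 ** h)) = \<mu>1"
    if "invertible h" "distr \<rho> borel_spd (congr h) = \<rho>" for h
  proof -
    have "\<mu>1 = distr (distr \<rho> borel_spd (congr h)) borel_spd (congr ?S1)" by (simp add: that assms(8))
    also have "\<dots> = distr \<rho> borel_spd (congr (?S1 ** h))"
      by (subst distr_distr[OF measurable_congr[OF Si(2)] measurable_prob_spd[OF \<rho> measurable_congr[OF that(1)]]])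
        (simp add: comp_def congr_congr)
    finally show ?thesis by simp
  qed
  have T\<mu>: "distr \<mu>0 borel_spd T = \<mu>1"
  proof -
    have "distr \<mu>0 borel_spd T = distr \<rho> borel_spd (congr (?S1 ** ?Q))"
      unfolding assms(7)
      by (subst distr_distr[OF Tm measurable_prob_spd[OF \<rho> measurable_congr[OF Si(1)]]])
        (simp add: comp_def T_S0)
    then show ?thesis by (simp add: push Qi Q\<rho>)
  qed
  note opt = congruence_transport_optimal[OF \<mu>0 int0 \<mu>1 int1 A, folded assms(11), OF T\<mu>]
  have plan: "unique_optimal_plan quad_cost \<mu>0 \<mu>1 (distr \<mu>0 (borel_spd \<Otimes>\<^sub>M borel_spd) (\<lambda>X. (X, T X)))"
    using opt(1) by (simp only: assms(11))
  let ?K = "kantorovich_cost quad_cost \<mu>0 \<mu>1"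

  have cost: "enn2ereal ?K = ereal (cost_formula a b \<Sigma>0 \<Sigma>1 C)" if iso: "isotropic_moments \<rho> a b" for a b
  proof -
    have sq: "(norm (X - T X))\<^sup>2 = (norm X)\<^sup>2 + (norm (T X))\<^sup>2 - 2 * (X \<bullet> T X)" for X
      by (simp add: power2_norm_eq_inner inner_diff inner_commute)
    \<comment> \<open>The cross term \<open>\<langle>X, T X\<rangle>\<close> is the squared norm minus the potential.\<close>
    have "integrable \<mu>0 (\<lambda>X. (norm X)\<^sup>2 - X \<bullet> (X - A ** X ** A))"
      by (intro Bochner_Integration.integrable_diff int0 integrable_potential \<mu>0)
    then have cr: "integrable \<mu>0 (\<lambda>X. X \<bullet> T X)"
      by (simp add: power2_norm_eq_inner inner_diff_right assms(11))
    have Tm0: "T \<in> \<mu>0 \<rightarrow>\<^sub>M borel_spd" by (rule measurable_prob_spd[OF \<mu>0 Tm])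
    have n: "(\<lambda>X :: real^'n^'n. (norm X)\<^sup>2) \<in> borel_measurable borel_spd"
      by (rule measurable_borel_spdI) simp
    have iT: "integrable \<mu>0 (\<lambda>X. (norm (T X))\<^sup>2)"
      using int1 unfolding T\<mu>[symmetric] by (simp add: integrable_distr_eq[OF Tm0 n])
    have iD: "integrable \<mu>0 (\<lambda>X. (norm (X - T X))\<^sup>2)"
      unfolding sq by (simp add: int0 iT cr)
    have "?K = (\<integral>\<^sup>+X. ennreal ((norm (X - T X))\<^sup>2) \<partial>\<mu>0)" by (simp add: opt(4) quad_cost_def assms(11))
    also have "\<dots> = ennreal (\<integral>X. (norm (X - T X))\<^sup>2 \<partial>\<mu>0)"
      by (rule nn_integral_eq_integral[OF iD]) simp
    finally have K: "enn2ereal ?K = ereal (\<integral>X. (norm (X - T X))\<^sup>2 \<partial>\<mu>0)" by simp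
    have "(\<integral>X. (norm (X - T X))\<^sup>2 \<partial>\<mu>0) =
        (\<integral>X. (norm X)\<^sup>2 \<partial>\<mu>0) + (\<integral>X. (norm (T X))\<^sup>2 \<partial>\<mu>0) - 2 * (\<integral>X. X \<bullet> T X \<partial>\<mu>0)"
      unfolding sq by (simp add: int0 iT cr)
    also have "(\<integral>X. (norm (T X))\<^sup>2 \<partial>\<mu>0) = (\<integral>X. (norm X)\<^sup>2 \<partial>\<mu>1)"
      unfolding T\<mu>[symmetric] by (rule integral_distr[OF Tm0 n, symmetric])
    also have "(\<integral>X. (norm X)\<^sup>2 \<partial>\<mu>0) = (a + b) * (\<Sigma>0 \<bullet> \<Sigma>0) + b * (trace \<Sigma>0)\<^sup>2"
      unfolding assms(7) isotropic_second_moment_congr[OF \<rho> int iso S(1)] S(3) ..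
    also have "(\<integral>X. (norm X)\<^sup>2 \<partial>\<mu>1) = (a + b) * (\<Sigma>1 \<bullet> \<Sigma>1) + b * (trace \<Sigma>1)\<^sup>2"
      unfolding assms(8) isotropic_second_moment_congr[OF \<rho> int iso S(2)] S(4) ..
    also have "(\<integral>X. X \<bullet> T X \<partial>\<mu>0) = (a + b) * (\<Sigma>0 \<bullet> \<Sigma>1) + b * (trace C)\<^sup>2"
      using isotropic_cross_moment_congr[OF \<rho> int iso S(1) A]
      by (simp add: C(1) inner_spd_sqrt_cross[OF \<Sigma> C(2,3)] T congr_def spd_sym[OF A] flip: assms(7))
    also have "(a + b) * (\<Sigma>0 \<bullet> \<Sigma>0) + b * (trace \<Sigma>0)\<^sup>2 + ((a + b) * (\<Sigma>1 \<bullet> \<Sigma>1) + b * (trace \<Sigma>1)\<^sup>2) -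
        2 * ((a + b) * (\<Sigma>0 \<bullet> \<Sigma>1) + b * (trace C)\<^sup>2) = cost_formula a b \<Sigma>0 \<Sigma>1 C"
      by (simp add: cost_formula_def power2_norm_eq_inner inner_diff inner_commute algebra_simps)
    finally show ?thesis using K by simp
  qed

  have J: "?K = J_cost quad_cost \<rho> ?S0 ?S1"
    unfolding J_cost_def
  proof (rule antisym[OF INF_greatest INF_lower2])
    fix h assume "h \<in> Stab_GL \<rho>"
    then have h: "invertible h" "distr \<rho> borel_spd (congr h) = \<rho>" by (auto simp: Stab_GL_def)
    note cm = coupling_of_maps[OF \<rho> measurable_congr[OF Si(1)] measurable_congr[OF invertible_mult[OF Si(2) h(1)]]]
    have "?K \<le> (\<integral>\<^sup>+(X, Y). quad_cost X Y \<partial>distr \<rho> (borel_spd \<Otimes>\<^sub>M borel_spd)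
        (\<lambda>X. (congr ?S0 X, congr (?S1 ** h) X)))"
      unfolding kantorovich_cost_def by (rule INF_lower) (use cm(1) push[OF h] assms(7) in simp)
    then show "?K \<le> (\<integral>\<^sup>+X. quad_cost (congr ?S0 X) (congr (?S1 ** h) X) \<partial>\<rho>)" by (simp only: cm(2))
  next
    show "?Q \<in> Stab_GL \<rho>" by (simp add: Stab_GL_def Qi Q\<rho>)
    have m: "(\<lambda>X. quad_cost X (T X)) \<in> borel_measurable borel_spd"
      using measurable_compose[OF measurable_Pair[OF measurable_ident_sets[OF refl] Tm] measurable_quad_cost]
      by simp
    have "?K = (\<integral>\<^sup>+X. quad_cost X (T X) \<partial>\<mu>0)" using opt(4) by (simp add: assms(11))
    also have "\<dots> = (\<integral>\<^sup>+X. quad_cost (congr ?S0 X) (T (congr ?S0 X)) \<partial>\<rho>)"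
      unfolding assms(7)
      by (rule nn_integral_distr[OF measurable_prob_spd[OF \<rho> measurable_congr[OF Si(1)]]]) (simp add: m)
    finally show "(\<integral>\<^sup>+X. quad_cost (congr ?S0 X) (congr (?S1 ** ?Q) X) \<partial>\<rho>) \<le> ?K"
      by (simp only: T_S0 order.refl)
  qed

  have dim_ge_2: "enn2ereal ?K = ereal (cost_formula (a_coeff \<rho>) (b_coeff \<rho>) \<Sigma>0 \<Sigma>1 C)" if d: "CARD('n) \<ge> 2"
  proof -
    obtain a b where iso: "isotropic_moments \<rho> a b" using isotropic_moments_exist[OF \<rho> inv int d] by blast
    then show ?thesis using cost[OF iso] isotropic_coeffs[OF \<rho> int iso d] by simp
  qed
  have dim_1: "cost_formula a b \<Sigma>0 \<Sigma>1 C = cost_formula a' b' \<Sigma>0 \<Sigma>1 C"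
    if d: "CARD('n) = 1" and ab: "a + 2 * b = a' + 2 * b'" for a b a' b'
  proof -
    \<comment> \<open>In dimension 1 the cost is \<open>(a + 2 b) (\<Sigma>0 - \<Sigma>1)\<^sup>2\<close>, because \<open>C\<^sup>2 = \<Sigma>0 \<Sigma>1\<close>.\<close>
    have trC: "(trace C)\<^sup>2 = trace \<Sigma>0 * trace \<Sigma>1"
      using inner_spd_sqrt_cross[OF \<Sigma> C(2,3)] by (simp add: inner_dim_1[OF d] power2_eq_square)
    have dist: "(norm (\<Sigma>0 - \<Sigma>1))\<^sup>2 = (trace \<Sigma>0 - trace \<Sigma>1)\<^sup>2"
      unfolding power2_norm_eq_inner inner_dim_1[OF d] trace_sub by (simp add: power2_eq_square)
    have "cost_formula x y \<Sigma>0 \<Sigma>1 C = (x + 2 * y) * (trace \<Sigma>0 - trace \<Sigma>1)\<^sup>2" for x y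
      unfolding cost_formula_def trC dist by (simp add: power2_eq_square algebra_simps)
    then show ?thesis using ab by simp
  qed
  show ?thesis
    using A plan opt(2,3) J dim_ge_2 dim_1 cost[OF isotropic_moments_dim_1] by blast
qed

end
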